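(* If $G$ is a connected graph of order $n$ each of whose blocks is a $2$-clique path, then $\operatorname{inertia}(\mathcal{D}(G))=(1,n-1,0)$.
   Context: A sequence of integers $q_1,\ldots,q_n$ ($n\ge 2$) is non-leaping if $q_1=0$, $q_2=1$, and $2\le q_k\le q_{k-1}+1$ for $k\ge3$. Set $b_k=k-q_k+1$. A neighborhood sequence of it is $W_1=\varnothing$, $W_2=\{1\}$, and for $k\ge3$, $W_k=\{a_k\}\cup\{b_k,\ldots,k-1\}$ with $a_k\in W_{k-1}$, $a_k<b_k$; its graph has vertex set $\{1,\ldots,n\}$ with vertex $k$ joined to all of $W_k$. A $2$-clique path is a graph of some neighborhood sequence of a sequence $0,1,2,\ldots,p_1-1,2,\ldots,p_2-1,\ldots,2,\ldots,p_m-1$ with $m\ge0$ and integers $p_i\ge3$ (equivalently, a graph obtained from disjoint cliques $K_{p_1},\ldots,K_{p_m}$ by gluing an edge of $K_{p_i}$ to an edge of $K_{p_{i+1}}$, no edge glued twice; $K_2$ is included for $m=0$). Blocks of a graph are its maximal connected induced subgraphs without a cut-vertex. $\mathcal{D}(G)$ is the distance matrix; inertia is the triple (number of positive, negative, zero eigenvalues). *)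

theory Defs
  imports "Graph_Theory.Graph_Theory" "Jordan_Normal_Form.Char_Poly"
begin

text \<open>
  Finite simple graphs are symmetric, loop-free digraphs without parallel arcs, i.e. the
  locale predicate \<open>graph\<close> of \<open>Graph_Theory\<close>: an undirected edge is a pair of opposite arcs.
\<close>

subsection \<open>Two-clique paths\<close>

text \<open>
  A sequence \<open>q\<^sub>1, \<dots>, q\<^sub>n\<close> is a list, so \<open>q\<^sub>k\<close> is \<open>q ! (k - 1)\<close>. Natural numbers suffice, since
  the conditions below force nonnegative entries.
\<close>

definition non_leaping :: "nat list \<Rightarrow> bool" where
  "non_leaping q \<longleftrightarrow> length q \<ge> 2 \<and> q ! 0 = 0 \<and> q ! 1 = 1 \<and>
     (\<forall>k\<in>{3..length q}. 2 \<le> q ! (k - 1) \<and> q ! (k - 1) \<le> q ! (k - 2) + 1)"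

text \<open>
  This is \<open>k - q\<^sub>k + 1\<close>. The subtraction does not truncate, because \<open>q\<^sub>k \<le> k - 1\<close> in a
  non-leaping sequence.
\<close>

definition b_index :: "nat list \<Rightarrow> nat \<Rightarrow> nat" where
  "b_index q k = k + 1 - q ! (k - 1)"

text \<open>Only the values of \<open>W\<close> at \<open>1, \<dots>, n\<close> matter, here and in \<open>nbhd_graph\<close>.\<close>

definition neighborhood_sequence :: "nat list \<Rightarrow> (nat \<Rightarrow> nat set) \<Rightarrow> bool" where
  "neighborhood_sequence q W \<longleftrightarrow> non_leaping q \<and> W 1 = {} \<and> W 2 = {1} \<and>
     (\<forall>k\<in>{3..length q}. \<exists>a\<in>W (k - 1). a < b_index q k \<and> W k = {a} \<union> {b_index q k..k - 1})"

definition nbhd_graph :: "nat \<Rightarrow> (nat \<Rightarrow> nat set) \<Rightarrow> nat pair_pre_digraph" where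
  "nbhd_graph n W =
     \<lparr>pverts = {1..n},
      parcs = {(k, j). k \<in> {1..n} \<and> j \<in> W k} \<union> {(j, k). k \<in> {1..n} \<and> j \<in> W k}\<rparr>"

text \<open>The sequence \<open>0, 1, 2, \<dots>, p\<^sub>1 - 1, 2, \<dots>, p\<^sub>2 - 1, \<dots>, 2, \<dots>, p\<^sub>m - 1\<close>.\<close>

definition clique_path_seq :: "nat list \<Rightarrow> nat list" where
  "clique_path_seq ps = [0, 1] @ concat (map (\<lambda>p. [2..<p]) ps)"

definition two_clique_path :: "('a, 'b) pre_digraph \<Rightarrow> bool" where
  "two_clique_path G \<longleftrightarrow>
     (\<exists>ps W. (\<forall>p\<in>set ps. p \<ge> 3) \<and> neighborhood_sequence (clique_path_seq ps) W \<and>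
        digraph_iso (with_proj (nbhd_graph (length (clique_path_seq ps)) W)) G)"

subsection \<open>Blocks\<close>

definition cut_vertex :: "('a, 'b) pre_digraph \<Rightarrow> 'a \<Rightarrow> bool" where
  "cut_vertex G v \<longleftrightarrow> v \<in> verts G \<and>
     (\<exists>x\<in>verts G - {v}. \<exists>y\<in>verts G - {v}.
        x \<rightarrow>\<^sup>*\<^bsub>G\<^esub> y \<and> \<not> x \<rightarrow>\<^sup>*\<^bsub>pre_digraph.del_vert G v\<^esub> y)"

definition is_block :: "('a, 'b) pre_digraph \<Rightarrow> ('a, 'b) pre_digraph \<Rightarrow> bool" where
  "is_block H G \<longleftrightarrow>
     pre_digraph.max_subgraph G
       (\<lambda>K. induced_subgraph K G \<and> Digraph_Component.connected K \<and> (\<nexists>v. cut_vertex K v)) H"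

subsection \<open>Distance matrix and inertia\<close>

definition graph_dist :: "('a, 'b) pre_digraph \<Rightarrow> 'a \<Rightarrow> 'a \<Rightarrow> real" where
  "graph_dist G u v = real_of_ereal (wf_digraph.\<mu> G (\<lambda>_. 1) u v)"

text \<open>Rows and columns are indexed by an enumeration \<open>vs\<close> of the vertices.\<close>

definition distance_matrix :: "('a, 'b) pre_digraph \<Rightarrow> 'a list \<Rightarrow> real mat" where
  "distance_matrix G vs =
     mat (length vs) (length vs) (\<lambda>(i, j). graph_dist G (vs ! i) (vs ! j))"

text \<open>
  Eigenvalues are counted with algebraic multiplicity. Only real eigenvalues are considered,
  which are all of them for a symmetric matrix.
\<close>

definition num_eigenvalues_in :: "real mat \<Rightarrow> real set \<Rightarrow> nat" where
  "num_eigenvalues_in A S =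
     (\<Sum>x | eigenvalue A x \<and> x \<in> S. Polynomial.order x (char_poly A))"

definition inertia :: "real mat \<Rightarrow> nat \<times> nat \<times> nat" where
  "inertia A =
     (num_eigenvalues_in A {0<..}, num_eigenvalues_in A {..<0}, num_eigenvalues_in A {0})"

end

theory Submission
  imports Defs "Jordan_Normal_Form.Schur_Decomposition" "HOL-Analysis.Convex"
begin

text \<open>
  The distance matrix has strict negative type: its quadratic form is negative on nonzero vectors
  with entry sum \<open>0\<close>. Hence at most one eigenvalue is nonnegative, and since the trace vanishes
  there is exactly one, and it is positive.

  Strict negative type is inherited when two graphs are glued at a cut vertex \<open>c\<close>: subtracting
  suitable multiples of the unit vector at \<open>c\<close> splits the form as a direct sum. This reduces the
  claim to blocks. A \<open>2\<close>-clique path is built by adding vertices \<open>k\<close>, with predecessor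
  \<open>b = k - 1\<close>, in one of two ways: \<open>k\<close> is a twin of \<open>b\<close>, or \<open>k\<close> is joined to \<open>b\<close> and to one
  earlier neighbour \<open>a\<close> of \<open>b\<close>, and then \<open>d(k, j) = d(a, j) + 1\<close> for all \<open>j \<noteq> b\<close>. Moving the
  weight of \<open>k\<close> to its twin or to \<open>a\<close> reduces the form to the smaller graph up to the explicit
  terms \<open>2 x\<^sub>k x\<^sub>b\<close> and \<open>- 2 x\<^sub>k (x\<^sub>k + x\<^sub>b)\<close>, respectively.
\<close>

subsection \<open>Negative type along a clique path\<close>

text \<open>
  These local conditions pin down the graph distance uniquely. They allow distance functions to be
  written down explicitly, without walks in induced subgraphs.
\<close>

definition distance_on :: "('a \<Rightarrow> 'a \<Rightarrow> bool) \<Rightarrow> 'a set \<Rightarrow> ('a \<Rightarrow> 'a \<Rightarrow> nat) \<Rightarrow> bool" where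
  "distance_on E V d \<longleftrightarrow>
     (\<forall>u\<in>V. d u u = 0) \<and> (\<forall>u\<in>V. \<forall>v\<in>V. d u v = d v u) \<and>
     (\<forall>u\<in>V. \<forall>v\<in>V. \<forall>w\<in>V. E v w \<longrightarrow> d u w \<le> Suc (d u v)) \<and>
     (\<forall>u\<in>V. \<forall>v\<in>V. u \<noteq> v \<longrightarrow> (\<exists>w\<in>V. E w v \<and> d u v = Suc (d u w)))"

lemma distance_onD:
  assumes "distance_on E V d" "u \<in> V" "v \<in> V"
  shows "d u u = 0" "d u v = d v u" "w \<in> V \<Longrightarrow> E v w \<Longrightarrow> d u w \<le> Suc (d u v)"
    "u \<noteq> v \<Longrightarrow> \<exists>w\<in>V. E w v \<and> d u v = Suc (d u w)"
  using assms unfolding distance_on_def by blast+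

section \<open>The quadratic form of a distance function\<close>

definition dform :: "'a set \<Rightarrow> ('a \<Rightarrow> 'a \<Rightarrow> nat) \<Rightarrow> ('a \<Rightarrow> real) \<Rightarrow> real" where
  "dform V d x = (\<Sum>u\<in>V. \<Sum>v\<in>V. x u * x v * real (d u v))"

definition strict_negative_type :: "'a set \<Rightarrow> ('a \<Rightarrow> 'a \<Rightarrow> nat) \<Rightarrow> bool" where
  "strict_negative_type V d \<longleftrightarrow>
     (\<forall>x. sum x V = 0 \<longrightarrow> (\<exists>v\<in>V. x v \<noteq> 0) \<longrightarrow> dform V d x < 0)"

lemma dform_cong:
  assumes "\<And>u. u \<in> V \<Longrightarrow> x u = y u" "\<And>u v. u \<in> V \<Longrightarrow> v \<in> V \<Longrightarrow> d u v = e u v"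
  shows "dform V d x = dform V e y"
  unfolding dform_def using assms by (intro sum.cong) auto

lemma dform_insert:
  assumes "finite S" "v \<notin> S" "d v v = 0" "\<And>u. u \<in> S \<Longrightarrow> d v u = d u v"
  shows "dform (insert v S) d x = dform S d x + 2 * x v * (\<Sum>u\<in>S. x u * real (d u v))"
proof -
  have "(\<Sum>w\<in>S. x v * x w * real (d v w)) = x v * (\<Sum>u\<in>S. x u * real (d u v))"
    unfolding sum_distrib_left using assms(4) by (intro sum.cong) auto
  moreover have "(\<Sum>u\<in>S. x u * x v * real (d u v)) = x v * (\<Sum>u\<in>S. x u * real (d u v))"
    unfolding sum_distrib_left by (intro sum.cong) auto
  ultimately show ?thesis
    using assms(1-3) unfolding dform_def by (simp add: sum.distrib algebra_simps)
qed

text \<open>The form is affine in a single weight: \<open>d p p = 0\<close> removes the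
  \<open>t\<^sup>2\<close> term, and symmetry doubles the linear one.\<close>

lemma dform_shift:
  assumes "finite V" "p \<in> V" "d p p = 0" "\<And>u. u \<in> V \<Longrightarrow> d p u = d u p"
  shows "dform V d (x(p := x p + t)) = dform V d x + 2 * t * (\<Sum>u\<in>V. x u * real (d u p))"
proof -
  let ?S = "V - {p}" and ?y = "x(p := x p + t)"
  have V: "V = insert p ?S" using assms(2) by blast
  have 1: "dform V d z = dform ?S d z + 2 * z p * (\<Sum>u\<in>?S. z u * real (d u p))" for z
    using dform_insert[of ?S p d z, folded V] assms by blast
  have 2: "dform ?S d ?y = dform ?S d x" by (rule dform_cong) auto
  have 3: "(\<Sum>u\<in>?S. ?y u * real (d u p)) = (\<Sum>u\<in>?S. x u * real (d u p))"
    by (rule sum.cong) auto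
  have 4: "(\<Sum>u\<in>V. x u * real (d u p)) = (\<Sum>u\<in>?S. x u * real (d u p))"
    using assms(1-3) by (simp add: sum.remove[of V p])
  show ?thesis unfolding 1[of ?y] 1[of x] 2 3 4 by (simp add: algebra_simps)
qed

section \<open>Adjoining a vertex whose neighbourhood is a clique\<close>

definition adjoin :: "'a \<Rightarrow> ('a \<Rightarrow> nat) \<Rightarrow> ('a \<Rightarrow> 'a \<Rightarrow> nat) \<Rightarrow> 'a \<Rightarrow> 'a \<Rightarrow> nat" where
  "adjoin k g d u v = (if u = k then if v = k then 0 else g v else if v = k then g u else d u v)"

text \<open>The last two hypotheses say that \<open>g u\<close> is one more than the distance from
  \<open>u\<close> to the nearest vertex of \<open>W\<close>. Since \<open>W\<close> is a clique, a
  detour through \<open>k\<close> never shortens a path, so the old distances survive.\<close>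

lemma distance_on_adjoin:
  assumes d: "distance_on E V d" and k: "k \<notin> V" "\<not> E k k" and W: "W \<subseteq> V"
    and N: "\<And>v. v \<in> V \<Longrightarrow> E k v \<longleftrightarrow> v \<in> W" and sym: "\<And>u v. E u v \<Longrightarrow> E v u"
    and clique: "\<And>u v. u \<in> W \<Longrightarrow> v \<in> W \<Longrightarrow> u \<noteq> v \<Longrightarrow> E u v"
    and g: "\<And>u. u \<in> V \<Longrightarrow> \<exists>w\<in>W. g u = Suc (d u w)"
    and gle: "\<And>u w. u \<in> V \<Longrightarrow> w \<in> W \<Longrightarrow> g u \<le> Suc (d u w)"
  shows "distance_on E (insert k V) (adjoin k g d)"
proof -
  note D = distance_onD[OF d]
  have Vk: "v \<in> V \<Longrightarrow> v \<noteq> k" for v using k by blast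
  have WV: "w \<in> W \<Longrightarrow> w \<in> V" for w using W by blast
  have gW: "g w = 1" if "w \<in> W" for w
  proof -
    have "g w \<le> Suc 0" using gle[of w w] D(1)[of w w] that W by auto
    moreover have "\<exists>w'\<in>W. g w = Suc (d w w')" using g that W by blast
    ultimately show ?thesis by auto
  qed
  have glip: "g v \<le> Suc (g u)" if "u \<in> V" "v \<in> V" "E u v" for u v
  proof -
    obtain w where w: "w \<in> W" "g u = Suc (d u w)" using g \<open>u \<in> V\<close> by blast
    have "d w v \<le> Suc (d w u)" using D(3)[of w u v] w that WV[of w] by auto
    then show ?thesis using gle[of v w] D(2)[of w u] D(2)[of w v] w that WV[of w] by auto
  qed
  \<comment> \<open>The Lipschitz condition across the edges between \<open>k\<close> and
    \<open>W\<close>. The first bound is where the clique hypothesis enters.\<close>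
  have gk: "d u w \<le> Suc (g u)" "g u \<le> Suc (d u w)" if "u \<in> V" "w \<in> W" for u w
  proof -
    obtain w' where w: "w' \<in> W" "g u = Suc (d u w')" using g \<open>u \<in> V\<close> by blast
    have "d u w \<le> Suc (d u w')"
      using D(3)[of u w' w] clique[of w' w] w that subsetD[OF W] by (cases "w = w'") auto
    then show "d u w \<le> Suc (g u)" using w by simp
    show "g u \<le> Suc (d u w)" using gle that by blast
  qed
  \<comment> \<open>A neighbour of \<open>u\<close> closer to \<open>k\<close>: it is
    \<open>k\<close> itself if the nearest \<open>w\<close> is \<open>u\<close>, and otherwise the
    vertex before \<open>u\<close> on a shortest path from \<open>w\<close>.\<close>
  have gdesc: "\<exists>w\<in>insert k V. E w u \<and> g u = Suc (adjoin k g d k w)" if "u \<in> V" for u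
  proof -
    obtain w where w: "w \<in> W" "g u = Suc (d u w)" using g \<open>u \<in> V\<close> by blast
    have [simp]: "u \<noteq> k" using that k by auto
    show ?thesis
    proof (cases "u = w")
      case True
      then show ?thesis using w D(1)[of u u] that N[of u] sym
        by (intro bexI[of _ k]) (auto simp: adjoin_def)
    next
      case False
      then obtain z where z: "z \<in> V" "E z u" "d w u = Suc (d w z)"
        using D(4)[of w u] w(1) WV[of w] \<open>u \<in> V\<close> by blast
      have "g z \<le> d u w" using gle[of z w] z w WV[of w] that D(2)[of w z] D(2)[of w u] by auto
      moreover have "g u \<le> Suc (g z)" using glip[of z u] z that sym by auto
      ultimately have "g u = Suc (g z)" using w by simp
      then show ?thesis using z k by (intro bexI[of _ z]) (auto simp: adjoin_def)
    qed
  qed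
  have kdesc: "\<exists>w\<in>insert k V. E w k \<and> g u = Suc (adjoin k g d u w)" if "u \<in> V" for u
  proof -
    obtain w where w: "w \<in> W" "g u = Suc (d u w)" using g \<open>u \<in> V\<close> by blast
    then show ?thesis using that k WV[of w] N[of w] sym
      by (intro bexI[of _ w]) (auto simp: adjoin_def)
  qed
  have a: "adjoin k g d k k = 0" "u \<in> V \<Longrightarrow> adjoin k g d u k = g u"
    "u \<in> V \<Longrightarrow> adjoin k g d k u = g u" 
    "u \<in> V \<Longrightarrow> v \<in> V \<Longrightarrow> adjoin k g d u v = d u v" for u v
    using k by (auto simp: adjoin_def)
  show ?thesis unfolding distance_on_def
  proof (intro conjI ballI impI)
    fix u assume "u \<in> insert k V"
    then show "adjoin k g d u u = 0" using a D(1) by auto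
  next
    fix u v assume "u \<in> insert k V" "v \<in> insert k V"
    then show "adjoin k g d u v = adjoin k g d v u" using a D(2) by auto
  next
    fix u v w assume *: "u \<in> insert k V" "v \<in> insert k V" "w \<in> insert k V" "E v w"
    have "v \<in> W" if "w = k" "v \<noteq> k" using that * N sym by auto
    have "w \<in> W" if "v = k" "w \<noteq> k" using that * N sym by auto
    consider "w = v" | "u = k" "v = k" "w \<in> V" | "u = k" "v \<in> V" "w = k" | "u = k" "v \<in> V" "w \<in> V"
      | "u \<in> V" "v = k" "w \<in> V" | "u \<in> V" "v \<in> V" "w = k" | "u \<in> V" "v \<in> V" "w \<in> V"
      using * by blast
    then show "adjoin k g d u w \<le> Suc (adjoin k g d u v)"
    proof cases
      case 1
      then show ?thesis by simp
    next
      case 2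
      then show ?thesis using a gW[of w] \<open>v = k \<Longrightarrow> w \<noteq> k \<Longrightarrow> w \<in> W\<close> Vk[of w] by auto
    next
      case 3
      then show ?thesis using a by simp
    next
      case 4
      then show ?thesis using a glip *(4) by simp
    next
      case 5
      then show ?thesis using a gk(1)[of u w] \<open>v = k \<Longrightarrow> w \<noteq> k \<Longrightarrow> w \<in> W\<close> Vk[of w] by auto
    next
      case 6
      then show ?thesis using a gk(2)[of u v] \<open>w = k \<Longrightarrow> v \<noteq> k \<Longrightarrow> v \<in> W\<close> Vk[of v] by auto
    next
      case 7
      then show ?thesis using a D(3) *(4) by simp
    qed
  next
    fix u v assume *: "u \<in> insert k V" "v \<in> insert k V" "u \<noteq> v"
    consider "u = k" "v \<in> V" | "v = k" "u \<in> V" | "u \<in> V" "v \<in> V" using * by auto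
    then show "\<exists>w\<in>insert k V. E w v \<and> adjoin k g d u v = Suc (adjoin k g d u w)"
    proof cases
      case 1 then show ?thesis using gdesc a by auto
    next
      case 2 then show ?thesis using kdesc a by auto
    next
      case 3
      then obtain w where "w \<in> V" "E w v" "d u v = Suc (d u w)" using D(4) * by blast
      then show ?thesis using a 3 by (intro bexI[of _ w]) auto
    qed
  qed
qed

text \<open>
  The quadratic bound is what makes the induction along the path work: it absorbs the mixed
  term \<open>x\<^sub>k x\<^sub>b\<close> created by a new vertex \<open>k\<close> with predecessor \<open>b\<close>.
\<close>

definition strong_negative_type :: "'a set \<Rightarrow> ('a \<Rightarrow> 'a \<Rightarrow> nat) \<Rightarrow> 'a \<Rightarrow> bool" where
  "strong_negative_type V d k \<longleftrightarrow> strict_negative_type V d \<and>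
     (\<forall>x. sum x V = 0 \<longrightarrow> dform V d x \<le> - (x k)\<^sup>2)"

text \<open>The weight of \<open>k\<close> moves onto \<open>p\<close>, which keeps the total at 0.
  The case \<open>p = b\<close> is the twin; any other \<open>p\<close> is the earlier neighbour
  \<open>a\<close>. Hypothesis \<open>eq\<close> evaluates the difference of the distance rows of
  \<open>k\<close> and \<open>p\<close>, which is all that distinguishes the two
  constructions.\<close>

lemma strong_negative_type_adjoin:
  assumes V: "finite V" "k \<notin> V" and d: "distance_on E V d" and b: "b \<in> V" and p: "p \<in> V"
    and neg: "strong_negative_type V d b"
    and eq: "\<And>x. sum x V = - x k \<Longrightarrow>
      (\<Sum>u\<in>V. x u * (real (g u) - real (d u p))) = (if p = b then x b else - x k - x b)"
  shows "strong_negative_type (insert k V) (adjoin k g d) k"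
proof -
  define y where "y x = x(p := x p + x k)" for x :: "'a \<Rightarrow> real"
  have sy: "sum (y x) V = 0" if "sum x (insert k V) = 0" for x
  proof -
    have "sum (y x) V = (x p + x k) + sum x (V - {p})"
      using V p by (simp add: sum.remove[of V p] y_def)
    then show ?thesis using that V p by (simp add: sum.remove[of V p])
  qed
  have form: "dform (insert k V) (adjoin k g d) x
      = dform V d (y x) + 2 * x k * (if p = b then x b else - x k - x b)"
    if "sum x (insert k V) = 0" for x
  proof -
    have "dform (insert k V) (adjoin k g d) x
       = dform V (adjoin k g d) x + 2 * x k * (\<Sum>u\<in>V. x u * real (adjoin k g d u k))"
      using V by (intro dform_insert) (auto simp: adjoin_def)
    moreover have "dform V (adjoin k g d) x = dform V d x"
      using V by (intro dform_cong) (auto simp: adjoin_def)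
    moreover have "(\<Sum>u\<in>V. x u * real (adjoin k g d u k)) = (\<Sum>u\<in>V. x u * real (g u))"
      using V by (intro sum.cong) (auto simp: adjoin_def)
    moreover have "dform V d (y x) = dform V d x + 2 * x k * (\<Sum>u\<in>V. x u * real (d u p))"
      unfolding y_def using V p distance_onD[OF d] by (intro dform_shift) auto
    moreover have "(\<Sum>u\<in>V. x u * (real (g u) - real (d u p)))
      = (\<Sum>u\<in>V. x u * real (g u)) - (\<Sum>u\<in>V. x u * real (d u p))"
      by (simp add: right_diff_distrib sum_subtractf)
    ultimately have "dform (insert k V) (adjoin k g d) x = dform V d (y x)
        + 2 * x k * (\<Sum>u\<in>V. x u * (real (g u) - real (d u p)))"
      by (simp add: right_diff_distrib)
    moreover have "sum x V = - x k" using that V by simp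
    ultimately show ?thesis using eq[of x] by simp
  qed
  have le: "dform (insert k V) (adjoin k g d) x \<le> - (x k)\<^sup>2"
    if s: "sum x (insert k V) = 0" for x
  proof -
    have n: "dform V d (y x) \<le> - (y x b)\<^sup>2"
      using neg sy[OF s] unfolding strong_negative_type_def by blast
    show ?thesis
    proof (cases "p = b")
      case True
      then have "y x b = x b + x k" by (simp add: y_def)
      then have "dform (insert k V) (adjoin k g d) x \<le> - (x b + x k)\<^sup>2 + 2 * x k * x b"
        using form[OF s] n True by simp
      \<comment> \<open>The mixed terms cancel, leaving
        \<open>- (x b)\<^sup>2 - (x k)\<^sup>2\<close> on the left.\<close>
      also have "\<dots> \<le> - (x k)\<^sup>2" by (simp add: power2_eq_square algebra_simps)
      finally show ?thesis .
    next
      case False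
      then have "y x b = x b" by (simp add: y_def)
      then have "dform (insert k V) (adjoin k g d) x \<le> - (x b)\<^sup>2 + 2 * x k * (- x k - x b)"
        using form[OF s] n False by simp
      also have "\<dots> = - (x b + x k)\<^sup>2 - (x k)\<^sup>2" by (simp add: power2_eq_square algebra_simps)
      also have "\<dots> \<le> - (x k)\<^sup>2" by simp
      finally show ?thesis .
    qed
  qed
  moreover have "strict_negative_type (insert k V) (adjoin k g d)"
    unfolding strict_negative_type_def
  proof (intro allI impI)
    fix x :: "'a \<Rightarrow> real"
    assume s: "sum x (insert k V) = 0" and nz: "\<exists>v\<in>insert k V. x v \<noteq> 0"
    show "dform (insert k V) (adjoin k g d) x < 0"
    \<comment> \<open>For \<open>x k \<noteq> 0\<close> the quadratic bound is already strict; for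
      \<open>x k = 0\<close> no weight moves, and strictness comes from the smaller set.\<close>
    proof (cases "x k = 0")
      case True
      then have "y x = x" by (simp add: y_def fun_eq_iff)
      moreover have "\<exists>v\<in>V. x v \<noteq> 0" using nz True by auto
      moreover have "sum x V = 0" using s True V by simp
      ultimately show ?thesis
        using form[OF s] neg True
        unfolding strong_negative_type_def strict_negative_type_def by auto
    next
      case False
      then have "0 < (x k)\<^sup>2" by simp
      then show ?thesis using le[OF s] by linarith
    qed
  qed
  ultimately show ?thesis unfolding strong_negative_type_def by blast
qed

section \<open>Induction along a clique path\<close>

definition path_edge :: "(nat \<Rightarrow> nat set) \<Rightarrow> nat \<Rightarrow> nat \<Rightarrow> nat \<Rightarrow> bool" where
  "path_edge W n i j \<longleftrightarrow> (i \<in> {1..n} \<and> j \<in> W i) \<or> (j \<in> {1..n} \<and> i \<in> W j)"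

lemma path_nbhd_subset:
  fixes W :: "nat \<Rightarrow> nat set"
  assumes W1: "W 1 = {}"
    and step: "\<And>k. 2 \<le> k \<Longrightarrow> k \<le> n \<Longrightarrow>
      (\<exists>a\<in>W (k - 1). W k = {a, k - 1}) \<or> W k = insert (k - 1) (W (k - 1))"
    and k: "1 \<le> k" "k \<le> n"
  shows "W k \<subseteq> {1..<k}"
  using k
proof (induction k rule: nat_induct_at_least)
  case base
  then show ?case using W1 by simp
next
  case (Suc b)
  then have "W b \<subseteq> {1..<b}" by simp
  with step[of "Suc b"] Suc show ?case by fastforce
qed

text \<open>Induction over the initial segments \<open>{1..k}\<close>, with \<open>n\<close> fixed
  so that the edge relation does not change with \<open>k\<close>. That \<open>W k\<close> is a
  clique is carried along because \<open>distance_on_adjoin\<close> requires it. At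
  \<open>k = 2\<close> only the second alternative of \<open>step\<close> can occur, since
  \<open>W 1\<close> is empty.\<close>

lemma path_negative_type:
  fixes W :: "nat \<Rightarrow> nat set"
  assumes W1: "W 1 = {}"
    and step: "\<And>k. 2 \<le> k \<Longrightarrow> k \<le> n \<Longrightarrow>
      (\<exists>a\<in>W (k - 1). W k = {a, k - 1}) \<or> W k = insert (k - 1) (W (k - 1))"
    and k: "1 \<le> k" "k \<le> n"
  shows "(\<forall>u\<in>W k. \<forall>v\<in>W k. u \<noteq> v \<longrightarrow> path_edge W n u v) \<and>
    (\<exists>d. distance_on (path_edge W n) {1..k} d \<and> strong_negative_type {1..k} d k)"
  using k
proof (induction k rule: nat_induct_at_least)
  case base
  have "distance_on (path_edge W n) {1..1} (\<lambda>_ _. 0)" by (auto simp: distance_on_def)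
  moreover have "strong_negative_type {1..1} (\<lambda>_ _. 0) (1::nat)"
    by (auto simp: strong_negative_type_def strict_negative_type_def dform_def)
  ultimately show ?case using W1 by auto
next
  case (Suc b)
  let ?k = "Suc b" and ?V = "{1..b}" and ?E = "path_edge W n"
  from Suc obtain d where
    cl: "\<And>u v. u \<in> W b \<Longrightarrow> v \<in> W b \<Longrightarrow> u \<noteq> v \<Longrightarrow> ?E u v"
    and d: "distance_on ?E ?V d" and neg: "strong_negative_type ?V d b" by auto
  note D = distance_onD[OF d]
  have sub: "W i \<subseteq> {1..<i}" if "i \<in> {1..?k}" for i
    using path_nbhd_subset[where n = n, OF W1 step] that Suc by auto
  have bV: "b \<in> ?V" and Wb: "W b \<subseteq> ?V" using Suc sub[of b] by auto
  have sym: "?E u v \<Longrightarrow> ?E v u" for u v by (auto simp: path_edge_def)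
  have Eb: "?E w b \<longleftrightarrow> w \<in> W b" if "w \<in> ?V" for w
    using sub[of w] sub[of b] that Suc by (auto simp: path_edge_def)
  have Ek: "?E ?k w \<longleftrightarrow> w \<in> W ?k" if "w \<in> ?V" for w
    using sub[of w] sub[of ?k] that Suc by (force simp: path_edge_def)
  have kk: "?k \<notin> ?V" "\<not> ?E ?k ?k"
    using sub[of ?k] by (auto simp: path_edge_def)
  have Wk: "W ?k \<subseteq> ?V" using sub[of ?k] by force
  have rem: "sum f ?V = f b + sum f (?V - {b})" for f :: "nat \<Rightarrow> real"
    using bV by (intro sum.remove) auto
  have insV: "insert ?k ?V = {1..?k}" by auto
  \<comment> \<open>Inside \<open>?V\<close> the neighbours of \<open>b\<close> are exactly
    \<open>W b\<close>, so the last edge of a shortest path to \<open>b\<close> starts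
    there.\<close>
  have red: "\<exists>w\<in>W b. d u b = Suc (d u w)" if "u \<in> ?V" "u \<noteq> b" for u
    using D(4)[of u b] that bV Eb by auto
  have lip: "d u b \<le> Suc (d u w)" if "u \<in> ?V" "w \<in> W b" for u w
    using D(3)[of u w b] that bV Wb Eb[of w] by auto
  have clique: "u \<in> W ?k \<Longrightarrow> v \<in> W ?k \<Longrightarrow> u \<noteq> v \<Longrightarrow> ?E u v" for u v
  proof -
    have "W ?k \<subseteq> insert b (W b)" using step[of ?k] Suc by auto
    then show "u \<in> W ?k \<Longrightarrow> v \<in> W ?k \<Longrightarrow> u \<noteq> v \<Longrightarrow> ?E u v"
      using cl Eb Wb sym by blast
  qed
  have finish: ?case if "distance_on ?E (insert ?k ?V) (adjoin ?k g d)"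
      "strong_negative_type (insert ?k ?V) (adjoin ?k g d) ?k" for g
    using that clique unfolding insV by blast
  consider a where "a \<in> W b" "W ?k = {a, b}" | "W ?k = insert b (W b)"
    using step[of ?k] Suc by auto
  then show ?case
  proof cases
    case 1
    \<comment> \<open>Of the two neighbours \<open>a\<close> and \<open>b\<close> of the new vertex,
      \<open>a\<close> is at least as close to every \<open>u \<noteq> b\<close>.\<close>
    define g where "g u = (if u = b then 1 else Suc (d u a))" for u
    have aV: "a \<in> ?V" "a \<noteq> b" using 1 sub[of b] Suc by auto
    \<comment> \<open>A shortest path to \<open>b\<close> enters through some \<open>w\<close> in
      the clique \<open>W b\<close>, and this \<open>w\<close> equals \<open>a\<close> or is
      adjacent to it.\<close>
    have ab: "d u a \<le> d u b" if u: "u \<in> ?V" "u \<noteq> b" for u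
    proof -
      obtain w where w: "w \<in> W b" "d u b = Suc (d u w)" using red u by blast
      have "d u a \<le> Suc (d u w)" if "w \<noteq> a"
        using D(3)[of u w a] cl[of w a] 1(1) u(1) w(1) Wb aV(1) that by blast
      then show ?thesis using w(2) by (cases "w = a") auto
    qed
    have dba: "d b a = 1"
    proof -
      have "d a b \<le> Suc 0" using lip[OF aV(1) 1(1)] D(1)[OF aV(1) aV(1)] by simp
      moreover have "d a b \<noteq> 0" using red[OF aV] by auto
      ultimately show ?thesis using D(2)[OF bV aV(1)] by simp
    qed
    have "distance_on ?E (insert ?k ?V) (adjoin ?k g d)"
      using 1 ab bV
      by (intro distance_on_adjoin[OF d kk Wk Ek sym clique]) (auto simp: g_def D(1)[OF bV bV])
    moreover have "strong_negative_type (insert ?k ?V) (adjoin ?k g d) ?k"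
    proof (rule strong_negative_type_adjoin[OF _ kk(1) d bV aV(1) neg])
      fix x :: "nat \<Rightarrow> real" assume x: "sum x ?V = - x ?k"
      \<comment> \<open>The rows of \<open>?k\<close> and \<open>a\<close> differ by 1 everywhere
        except at \<open>b\<close>, where both entries are 1.\<close>
      have "(\<Sum>u\<in>?V. x u * (real (g u) - real (d u a))) = (\<Sum>u\<in>?V - {b}. x u)"
        unfolding rem by (simp add: dba g_def)
      also have "\<dots> = sum x ?V - x b" unfolding rem by simp
      finally show "(\<Sum>u\<in>?V. x u * (real (g u) - real (d u a)))
        = (if a = b then x b else - x ?k - x b)" using aV x by simp
    qed simp
    ultimately show ?thesis by (rule finish)
  next
    case 2
    \<comment> \<open>The row of the twin \<open>b\<close>, except that the entry at
      \<open>b\<close> rises from 0 to 1; this one entry produces the term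
      \<open>x b\<close>.\<close>
    define g where "g u = (if u = b then 1 else d u b)" for u
    have gle: "g u \<le> Suc (d u w)" if "u \<in> ?V" "w \<in> W ?k" for u w
      using that 2 lip by (auto simp: g_def)
    have "distance_on ?E (insert ?k ?V) (adjoin ?k g d)"
    proof (rule distance_on_adjoin[OF d kk Wk Ek sym clique _ gle])
      fix u assume u: "u \<in> ?V"
      show "\<exists>w\<in>W ?k. g u = Suc (d u w)"
        using 2 red[OF u] D(1)[OF bV bV] by (auto simp: g_def)
    qed
    moreover have "strong_negative_type (insert ?k ?V) (adjoin ?k g d) ?k"
    proof (rule strong_negative_type_adjoin[OF _ kk(1) d bV bV neg])
      fix x :: "nat \<Rightarrow> real"
      show "(\<Sum>u\<in>?V. x u * (real (g u) - real (d u b)))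
        = (if b = b then x b else - x ?k - x b)"
        unfolding rem by (simp add: D(1)[OF bV bV] g_def)
    qed simp
    ultimately show ?thesis by (rule finish)
  qed
qed

subsection \<open>Gluing at a cut vertex\<close>

definition glue ::
  "'a set \<Rightarrow> 'a set \<Rightarrow> 'a \<Rightarrow> ('a \<Rightarrow> 'a \<Rightarrow> nat) \<Rightarrow> ('a \<Rightarrow> 'a \<Rightarrow> nat) \<Rightarrow> 'a \<Rightarrow> 'a \<Rightarrow> nat" where
  "glue A B c d e u w =
     (if u \<in> A \<and> w \<in> A then d u w
      else if u \<in> B \<and> w \<in> B then e u w
      else if u \<in> A then d u c + e c w
      else e u c + d c w)"

text \<open>The assumptions are symmetric in \<open>A\<close> and \<open>B\<close>, so one-sided
  facts are proved for the left side and transferred by \<open>swap\<close>.\<close>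

locale cut_gluing =
  fixes E :: "'a \<Rightarrow> 'a \<Rightarrow> bool" and A B :: "'a set" and c :: 'a
  assumes inter: "A \<inter> B = {c}"
    and sym: "E u v \<Longrightarrow> E v u"
    and no_edge: "u \<in> A - {c} \<Longrightarrow> v \<in> B - {c} \<Longrightarrow> \<not> E u v"
begin

lemma swap: "cut_gluing E B A c"
  using inter sym no_edge by unfold_locales blast+

lemma cut_mem: "c \<in> A" "c \<in> B"
  using inter by auto

context
  fixes d e :: "'a \<Rightarrow> 'a \<Rightarrow> nat"
  assumes d: "distance_on E A d" and e: "distance_on E B e"
begin

text \<open>Frees the formulas from the case order in \<open>glue\<close>: the cases overlap only at
  \<open>c\<close>, where they agree because \<open>d c c\<close> and \<open>e c c\<close> are
  0.\<close>

lemma glue_eq: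
  shows "u \<in> A \<Longrightarrow> w \<in> A \<Longrightarrow> glue A B c d e u w = d u w"
    and "u \<in> B \<Longrightarrow> w \<in> B \<Longrightarrow> glue A B c d e u w = e u w"
    and "u \<in> A \<Longrightarrow> w \<in> B \<Longrightarrow> glue A B c d e u w = d u c + e c w"
    and "u \<in> B \<Longrightarrow> w \<in> A \<Longrightarrow> glue A B c d e u w = e u c + d c w"
proof -
  have both: "z = c" if "z \<in> A" "z \<in> B" for z
    using inter that by blast
  have 0: "d c c = 0" "e c c = 0"
    using distance_onD(1)[OF d cut_mem(1) cut_mem(1)] distance_onD(1)[OF e cut_mem(2) cut_mem(2)] .
  show "glue A B c d e u w = d u w" if "u \<in> A" "w \<in> A"
    using that by (simp add: glue_def)
  show "glue A B c d e u w = e u w" if "u \<in> B" "w \<in> B"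
    using that both[of u] both[of w] 0
    by (cases "u \<in> A"; cases "w \<in> A") (simp_all add: glue_def)
  show "glue A B c d e u w = d u c + e c w" if "u \<in> A" "w \<in> B"
    using that both[of u] both[of w] 0
    by (cases "u \<in> B"; cases "w \<in> A") (simp_all add: glue_def)
  show "glue A B c d e u w = e u c + d c w" if "u \<in> B" "w \<in> A"
    using that both[of u] both[of w] 0
    by (cases "u \<in> A"; cases "w \<in> B") (simp_all add: glue_def)
qed

text \<open>Every edge lies within one side, so moving along it changes only the summand of that
  side, and each local condition reduces to the one for \<open>d\<close> or
  \<open>e\<close>.\<close>

lemma distance_on_glue: "distance_on E (A \<union> B) (glue A B c d e)"
proof -
  let ?g = "glue A B c d e"
  note dD = distance_onD[OF d] and eD = distance_onD[OF e]
  have edge: "v \<in> A \<and> w \<in> A \<or> v \<in> B \<and> w \<in> B" if "E v w" "v \<in> A \<union> B" "w \<in> A \<union> B" for v w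
    using that no_edge[of v w] no_edge[of w v] sym cut_mem by blast
  have lip: "?g u w \<le> Suc (?g u v)"
    if uvw: "u \<in> A \<union> B" "v \<in> A \<union> B" "w \<in> A \<union> B" "E v w" for u v w
  proof -
    consider "u \<in> A" "v \<in> A" "w \<in> A" | "u \<in> A" "v \<in> B" "w \<in> B"
      | "u \<in> B" "v \<in> A" "w \<in> A" | "u \<in> B" "v \<in> B" "w \<in> B"
      using edge[OF uvw(4,2,3)] uvw(1) by blast
    then show ?thesis
    proof cases
      case 1 then show ?thesis using dD(3) uvw(4) by (simp add: glue_eq(1))
    next
      case 2 then show ?thesis using eD(3)[OF cut_mem(2)] uvw(4) by (simp add: glue_eq(3))
    next
      case 3 then show ?thesis using dD(3)[OF cut_mem(1)] uvw(4) by (simp add: glue_eq(4))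
    next
      case 4 then show ?thesis using eD(3) uvw(4) by (simp add: glue_eq(2))
    qed
  qed
  have desc: "\<exists>w\<in>A \<union> B. E w v \<and> ?g u v = Suc (?g u w)"
    if uv: "u \<in> A \<union> B" "v \<in> A \<union> B" "u \<noteq> v" for u v
  proof -
    \<comment> \<open>For \<open>v = c\<close> both endpoints lie on one side, so in the mixed cases
      \<open>v \<noteq> c\<close> and the descent takes place on the side of \<open>v\<close>,
      measured from \<open>c\<close>.\<close>
    consider "u \<in> A" "v \<in> A" | "u \<in> A" "v \<in> B" "v \<noteq> c" | "u \<in> B" "v \<in> A" "v \<noteq> c" | "u \<in> B" "v \<in> B"
      using uv cut_mem by blast
    then show ?thesis
    proof cases
      case 1
      then obtain w where "w \<in> A" "E w v" "d u v = Suc (d u w)" using dD(4) \<open>u \<noteq> v\<close> by blast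
      then show ?thesis using 1 by (intro bexI[of _ w]) (auto simp: glue_eq(1))
    next
      case 2
      then obtain w where "w \<in> B" "E w v" "e c v = Suc (e c w)" using eD(4) cut_mem by blast
      then show ?thesis using 2 by (intro bexI[of _ w]) (auto simp: glue_eq(3))
    next
      case 3
      then obtain w where "w \<in> A" "E w v" "d c v = Suc (d c w)" using dD(4) cut_mem by blast
      then show ?thesis using 3 by (intro bexI[of _ w]) (auto simp: glue_eq(4))
    next
      case 4
      then obtain w where "w \<in> B" "E w v" "e u v = Suc (e u w)" using eD(4) \<open>u \<noteq> v\<close> by blast
      then show ?thesis using 4 by (intro bexI[of _ w]) (auto simp: glue_eq(2))
    qed
  qed
  have diag: "?g u u = 0" if "u \<in> A \<union> B" for u
    using that dD(1) eD(1) glue_eq(1,2) by fastforce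
  have symm: "?g u w = ?g w u" if uw: "u \<in> A \<union> B" "w \<in> A \<union> B" for u w
  proof -
    consider "u \<in> A" "w \<in> A" | "u \<in> A" "w \<in> B" | "u \<in> B" "w \<in> A" | "u \<in> B" "w \<in> B"
      using uw by blast
    then show ?thesis
    proof cases
      case 1 then show ?thesis using dD(2) by (simp add: glue_eq(1))
    next
      case 2 then show ?thesis
        using dD(2)[of u c] eD(2)[of c w] cut_mem by (simp add: glue_eq(3,4))
    next
      case 3 then show ?thesis
        using dD(2)[of c w] eD(2)[of u c] cut_mem by (simp add: glue_eq(3,4))
    next
      case 4 then show ?thesis using eD(2) by (simp add: glue_eq(2))
    qed
  qed
  show ?thesis
    unfolding distance_on_def using diag symm lip desc by blast
qed

text \<open>On each side the weight at \<open>c\<close> is reset so that the entries sum to 0.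
  Because distances across \<open>c\<close> are additive, the form of \<open>x\<close> is exactly
  the sum of the two resulting forms.\<close>

lemma strict_negative_type_glue:
  assumes fin: "finite A" "finite B" and neg: "strict_negative_type A d" "strict_negative_type B e"
  shows "strict_negative_type (A \<union> B) (glue A B c d e)"
  unfolding strict_negative_type_def
proof (intro allI impI)
  fix x :: "'a \<Rightarrow> real"
  assume s: "sum x (A \<union> B) = 0" and nz: "\<exists>v\<in>A \<union> B. x v \<noteq> 0"
  let ?g = "glue A B c d e" and ?A = "A - {c}" and ?B = "B - {c}"
  define xA xB where "xA = x(c := - sum x ?A)" and "xB = x(c := - sum x ?B)"
  define P Q where "P = (\<Sum>u\<in>?A. x u * real (d u c))" and "Q = (\<Sum>u\<in>?B. x u * real (e u c))"
  note dD = distance_onD[OF d] and eD = distance_onD[OF e]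
  have disj: "?A \<inter> ?B = {}" using inter by auto
  have AB: "A \<union> B = insert c (?A \<union> ?B)" and Aeq: "A = insert c ?A" and Beq: "B = insert c ?B"
    using cut_mem by auto
  have xc: "x c = - sum x ?A - sum x ?B"
    using s fin disj unfolding AB by (simp add: sum.union_disjoint)
  have dA: "dform A d xA = dform ?A d x - 2 * sum x ?A * P"
  proof -
    have "dform A d xA = dform ?A d xA + 2 * xA c * (\<Sum>u\<in>?A. xA u * real (d u c))"
      by (rule dform_insert[of ?A c d xA, folded Aeq])
        (use fin dD(1)[OF cut_mem(1) cut_mem(1)] dD(2)[OF cut_mem(1)] in auto)
    moreover have "dform ?A d xA = dform ?A d x" by (rule dform_cong) (auto simp: xA_def)
    moreover have "(\<Sum>u\<in>?A. xA u * real (d u c)) = P"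
      unfolding P_def by (rule sum.cong) (auto simp: xA_def)
    ultimately show ?thesis by (simp add: xA_def)
  qed
  have dB: "dform B e xB = dform ?B e x - 2 * sum x ?B * Q"
  proof -
    have "dform B e xB = dform ?B e xB + 2 * xB c * (\<Sum>u\<in>?B. xB u * real (e u c))"
      by (rule dform_insert[of ?B c e xB, folded Beq])
        (use fin eD(1)[OF cut_mem(2) cut_mem(2)] eD(2)[OF cut_mem(2)] in auto)
    moreover have "dform ?B e xB = dform ?B e x" by (rule dform_cong) (auto simp: xB_def)
    moreover have "(\<Sum>u\<in>?B. xB u * real (e u c)) = Q"
      unfolding Q_def by (rule sum.cong) (auto simp: xB_def)
    ultimately show ?thesis by (simp add: xB_def)
  qed
  have gA: "dform ?A ?g x = dform ?A d x" and gB: "dform ?B ?g x = dform ?B e x"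
    by (auto intro!: dform_cong simp: glue_eq(1,2))
  \<comment> \<open>Additivity of the distance turns the double sum into products of single
    sums.\<close>
  have cross1: "(\<Sum>u\<in>?A. \<Sum>w\<in>?B. x u * x w * real (?g u w)) = P * sum x ?B + sum x ?A * Q"
  proof -
    have "x u * x w * real (?g u w) = (x u * real (d u c)) * x w + x u * (x w * real (e w c))"
      if "u \<in> ?A" "w \<in> ?B" for u w
      using that eD(2)[of c w] cut_mem by (simp add: glue_eq(3) algebra_simps)
    then have "(\<Sum>u\<in>?A. \<Sum>w\<in>?B. x u * x w * real (?g u w))
      = (\<Sum>u\<in>?A. \<Sum>w\<in>?B. (x u * real (d u c)) * x w + x u * (x w * real (e w c)))"
      by (intro sum.cong) auto
    then show ?thesis unfolding P_def Q_def by (simp add: sum_product sum.distrib)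
  qed
  have cross2: "(\<Sum>u\<in>?B. \<Sum>w\<in>?A. x u * x w * real (?g u w)) = P * sum x ?B + sum x ?A * Q"
  proof -
    have "(\<Sum>u\<in>?B. \<Sum>w\<in>?A. x u * x w * real (?g u w)) = (\<Sum>w\<in>?A. \<Sum>u\<in>?B. x u * x w * real (?g u w))"
      by (rule sum.swap)
    also have "\<dots> = (\<Sum>w\<in>?A. \<Sum>u\<in>?B. x w * x u * real (?g w u))"
    proof (intro sum.cong refl)
      fix w u assume wu: "w \<in> ?A" "u \<in> ?B"
      then have "?g u w = ?g w u" using distance_onD(2)[OF distance_on_glue, of u w] by blast
      then show "x u * x w * real (?g u w) = x w * x u * real (?g w u)" by simp
    qed
    finally show ?thesis using cross1 by simp
  qed
  have union: "dform (?A \<union> ?B) ?g x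
      = dform ?A ?g x + dform ?B ?g x + 2 * (P * sum x ?B + sum x ?A * Q)"
    using fin disj cross1 cross2 unfolding dform_def by (simp add: sum.union_disjoint sum.distrib)
  have col: "(\<Sum>u\<in>?A \<union> ?B. x u * real (?g u c)) = P + Q"
    using fin disj cut_mem unfolding P_def Q_def by (simp add: sum.union_disjoint glue_eq(1,2))
  have "dform (A \<union> B) ?g x
      = dform (?A \<union> ?B) ?g x + 2 * x c * (\<Sum>u\<in>?A \<union> ?B. x u * real (?g u c))"
    unfolding AB
  proof (rule dform_insert)
    fix u assume "u \<in> ?A \<union> ?B"
    then show "?g c u = ?g u c"
      using distance_onD(2)[OF distance_on_glue, of c u] cut_mem by blast
  qed (use fin distance_onD(1)[OF distance_on_glue] cut_mem in auto)
  \<comment> \<open>Substituting \<open>xc\<close> cancels the mixed products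
    \<open>P * sum x ?B\<close> and \<open>sum x ?A * Q\<close>; only
    \<open>- 2 * sum x ?A * P\<close> and \<open>- 2 * sum x ?B * Q\<close> remain.\<close>
  also have "\<dots> = dform A d xA + dform B e xB"
    unfolding union col dA dB gA gB xc by (simp add: algebra_simps)
  finally have eq: "dform (A \<union> B) ?g x = dform A d xA + dform B e xB" .
  have sA: "sum xA A = 0"
  proof -
    have "sum xA ?A = sum x ?A" by (rule sum.cong) (auto simp: xA_def)
    then show ?thesis using sum.remove[OF fin(1) cut_mem(1), of xA] by (simp add: xA_def)
  qed
  have sB: "sum xB B = 0"
  proof -
    have "sum xB ?B = sum x ?B" by (rule sum.cong) (auto simp: xB_def)
    then show ?thesis using sum.remove[OF fin(2) cut_mem(2), of xB] by (simp add: xB_def)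
  qed
  have le0: "dform S f y \<le> 0" if "strict_negative_type S f" "sum y S = 0" for S f and y :: "'a \<Rightarrow> real"
  proof (cases "\<exists>v\<in>S. y v \<noteq> 0")
    case True then show ?thesis using that unfolding strict_negative_type_def by fastforce
  next
    case False then show ?thesis by (simp add: dform_def)
  qed
  \<comment> \<open>If both vectors vanished, \<open>x\<close> would vanish off \<open>c\<close>,
    and then at \<open>c\<close> too because its sum is 0.\<close>
  have "(\<exists>v\<in>A. xA v \<noteq> 0) \<or> (\<exists>v\<in>B. xB v \<noteq> 0)"
  proof (rule ccontr)
    assume "\<not> ?thesis"
    then have zA: "\<forall>v\<in>A. xA v = 0" and zB: "\<forall>v\<in>B. xB v = 0" by auto
    then have off: "x v = 0" if v: "v \<in> ?A \<union> ?B" for v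
    proof -
      have "xA v = x v" "xB v = x v" using v by (auto simp: xA_def xB_def)
      then show ?thesis using zA zB v by auto
    qed
    then have "x c = 0" unfolding xc by (simp add: sum.neutral)
    then show False using nz off AB by blast
  qed
  then have "dform A d xA < 0 \<or> dform B e xB < 0"
    using neg sA sB unfolding strict_negative_type_def by blast
  then show "dform (A \<union> B) ?g x < 0"
    unfolding eq using le0[OF neg(1) sA] le0[OF neg(2) sB] by linarith
qed

end

end

subsection \<open>Decomposition into blocks\<close>

definition edges_in :: "('a \<Rightarrow> 'a \<Rightarrow> bool) \<Rightarrow> 'a set \<Rightarrow> ('a \<times> 'a) set" where
  "edges_in E A = {(u, v). u \<in> A \<and> v \<in> A \<and> E u v}"

definition connected_in :: "('a \<Rightarrow> 'a \<Rightarrow> bool) \<Rightarrow> 'a set \<Rightarrow> bool" where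
  "connected_in E A \<longleftrightarrow> A \<noteq> {} \<and> (\<forall>u\<in>A. \<forall>v\<in>A. (u, v) \<in> (edges_in E A)\<^sup>*)"

text \<open>Singletons qualify, the second condition being vacuous for them.\<close>

definition biconnected_in :: "('a \<Rightarrow> 'a \<Rightarrow> bool) \<Rightarrow> 'a set \<Rightarrow> bool" where
  "biconnected_in E A \<longleftrightarrow> connected_in E A \<and>
     (\<forall>c\<in>A. \<forall>u\<in>A - {c}. \<forall>v\<in>A - {c}. (u, v) \<in> (edges_in E (A - {c}))\<^sup>*)"

definition block_in :: "('a \<Rightarrow> 'a \<Rightarrow> bool) \<Rightarrow> 'a set \<Rightarrow> 'a set \<Rightarrow> bool" where
  "block_in E V K \<longleftrightarrow> K \<subseteq> V \<and> biconnected_in E K \<and>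
     (\<forall>L\<subseteq>V. biconnected_in E L \<longrightarrow> K \<subseteq> L \<longrightarrow> L = K)"

context cut_gluing
begin

text \<open>A walk from a vertex of \<open>A\<close> to \<open>c\<close> stays in \<open>A\<close>
  until it first meets \<open>c\<close>, so its initial piece already connects the two inside
  \<open>A\<close>.\<close>

lemma connected_in_left:
  assumes "connected_in E (A \<union> B)"
  shows "connected_in E A"
proof -
  have reach: "z \<in> A \<Longrightarrow> (z, c) \<in> (edges_in E A)\<^sup>*" if "(z, c) \<in> (edges_in E (A \<union> B))\<^sup>*" for z
    using that
  proof (induction rule: converse_rtrancl_induct)
    case base
    then show ?case by simp
  next
    case (step y z)
    show ?case
    proof (cases "y = c")
      case False
      then have "z \<in> A" and "(y, z) \<in> edges_in E A"
        using step no_edge[of y z] cut_mem unfolding edges_in_def by auto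
      then show ?thesis using step.IH by (meson converse_rtrancl_into_rtrancl)
    qed simp
  qed
  have "sym (edges_in E A)" using sym unfolding sym_def edges_in_def by auto
  then have "sym ((edges_in E A)\<^sup>*)" by (rule sym_rtrancl)
  moreover have "(z, c) \<in> (edges_in E A)\<^sup>*" if "z \<in> A" for z
    using assms reach that cut_mem unfolding connected_in_def by blast
  ultimately show ?thesis
    using cut_mem unfolding connected_in_def by (meson empty_iff rtrancl_trans symD)
qed

text \<open>A biconnected set containing a vertex strictly on the left cannot cross the cut vertex.\<close>

lemma block_in_left:
  assumes "block_in E A K" "\<not> K \<subseteq> {c}"
  shows "block_in E (A \<union> B) K"
proof -
  obtain u where u: "u \<in> K" "u \<noteq> c" using assms(2) by auto
  have "L \<subseteq> A" if L: "L \<subseteq> A \<union> B" "biconnected_in E L" "K \<subseteq> L" for L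
  proof
    fix z assume z: "z \<in> L"
    show "z \<in> A"
    proof (cases "z = c")
      case False
      have "(u, z) \<in> (edges_in E (L - {c}))\<^sup>*"
      \<comment> \<open>If \<open>c\<close> lies outside \<open>L\<close>, then
        \<open>L - {c}\<close> is \<open>L\<close> and plain connectedness suffices.\<close>
      proof (cases "c \<in> L")
        case True
        then show ?thesis using L u z False unfolding biconnected_in_def by blast
      next
        case False
        then show ?thesis using L u z unfolding biconnected_in_def connected_in_def by auto
      qed
      then have "z \<in> A - {c}"
      proof (induction rule: rtrancl_induct)
        case base
        then show ?case using u assms(1) unfolding block_in_def by blast
      next
        case (step y z)
        then show ?case using no_edge[of y z] L(1) unfolding edges_in_def by auto
      qed
      then show ?thesis by simp
    qed (simp add: cut_mem)
  qed
  moreover have "K \<subseteq> A" "biconnected_in E K" "\<And>L. L \<subseteq> A \<Longrightarrow> biconnected_in E L \<Longrightarrow> K \<subseteq> L \<Longrightarrow> L = K"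
    using assms(1) unfolding block_in_def by blast+
  ultimately show ?thesis unfolding block_in_def by (meson le_supI1)
qed

end

text \<open>Strong induction on the number of vertices. A set that is not biconnected splits at a
  cut vertex into two smaller connected sets, whose blocks are again blocks of the whole, and the
  two distances are glued.\<close>

lemma strict_negative_type_from_blocks:
  fixes E :: "'a \<Rightarrow> 'a \<Rightarrow> bool"
  assumes "finite V" and sym: "\<And>u v. E u v \<Longrightarrow> E v u" and "connected_in E V"
    and "\<And>K. block_in E V K \<Longrightarrow> \<exists>d. distance_on E K d \<and> strict_negative_type K d"
  shows "\<exists>d. distance_on E V d \<and> strict_negative_type V d"
  using assms(1,3,4)
proof (induction "card V" arbitrary: V rule: less_induct)
  case less
  show ?case
  proof (cases "biconnected_in E V")
    case True
    then have "block_in E V V" unfolding block_in_def by blast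
    then show ?thesis by (rule less.prems(3))
  next
    case False
    then obtain c x y where c: "c \<in> V" and xy: "x \<in> V - {c}" "y \<in> V - {c}"
      and sep: "(x, y) \<notin> (edges_in E (V - {c}))\<^sup>*"
      using less.prems(2) unfolding biconnected_in_def by blast
    \<comment> \<open>\<open>X\<close> is the component of \<open>x\<close> after removal of
      \<open>c\<close>. Since \<open>y\<close> is missing from \<open>A\<close> and \<open>x\<close>
      from \<open>B\<close>, both parts are smaller than \<open>V\<close>.\<close>
    define X where "X = {z \<in> V - {c}. (x, z) \<in> (edges_in E (V - {c}))\<^sup>*}"
    define A where "A = insert c X"
    define B where "B = V - X"
    have X: "x \<in> X" "y \<notin> X" "c \<notin> X" "X \<subseteq> V" using xy sep by (auto simp: X_def)
    have V: "V = A \<union> B" "V = B \<union> A" using c X by (auto simp: A_def B_def)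
    interpret cut_gluing E A B c
    proof
      show "A \<inter> B = {c}" using c X by (auto simp: A_def B_def)
      fix u v assume uv: "u \<in> A - {c}" "v \<in> B - {c}"
      show "\<not> E u v"
      proof
        assume "E u v"
        then have "(u, v) \<in> edges_in E (V - {c})"
          using uv by (auto simp: edges_in_def A_def B_def X_def)
        then have "v \<in> X"
          using uv by (auto simp: A_def B_def X_def intro: rtrancl_into_rtrancl)
        then show False using uv by (simp add: B_def)
      qed
    qed (rule sym)
    interpret r: cut_gluing E B A c by (rule swap)
    \<comment> \<open>The transfer \<open>block_in_left\<close> excludes subsets of
      \<open>{c}\<close>; for these the zero function serves.\<close>
    have trivial_block: "\<exists>d. distance_on E K d \<and> strict_negative_type K d" if "K \<subseteq> {c}" for K
    proof -
      have "K = {} \<or> K = {c}" using that by blast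
      then have "distance_on E K (\<lambda>_ _. 0) \<and> strict_negative_type K (\<lambda>_ _. 0)"
        by (elim disjE) (simp_all add: distance_on_def strict_negative_type_def)
      then show ?thesis by blast
    qed
    have "\<exists>d. distance_on E A d \<and> strict_negative_type A d"
    proof (rule less.hyps)
      show "card A < card V" using xy X less.prems(1) c
        by (intro psubset_card_mono) (auto simp: A_def)
      show "finite A" using less.prems(1) V by (metis finite_Un)
      show "connected_in E A" using connected_in_left less.prems(2) V by metis
      show "\<exists>d. distance_on E K d \<and> strict_negative_type K d" if "block_in E A K" for K
        using trivial_block block_in_left[OF that] less.prems(3) V by metis
    qed
    moreover have "\<exists>d. distance_on E B d \<and> strict_negative_type B d"
    proof (rule less.hyps)
      show "card B < card V" using xy X less.prems(1) c
        by (intro psubset_card_mono) (auto simp: B_def)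
      show "finite B" using less.prems(1) V by (metis finite_Un)
      show "connected_in E B" using r.connected_in_left less.prems(2) V by metis
      show "\<exists>d. distance_on E K d \<and> strict_negative_type K d" if "block_in E B K" for K
        using trivial_block r.block_in_left[OF that] less.prems(3) V by metis
    qed
    ultimately obtain d e where "distance_on E A d" "strict_negative_type A d"
      "distance_on E B e" "strict_negative_type B e" by blast
    moreover have "finite A" "finite B" using less.prems(1) V by (metis finite_Un)+
    ultimately show ?thesis
      using distance_on_glue strict_negative_type_glue V by metis
  qed
qed

subsection \<open>Translation to the graph library\<close>

text \<open>Each run starts at 2 and then increases by 1, so the boundaries between runs fit the
  same pattern. The arbitrary prefix \<open>xs\<close> lets the induction append one run at a
  time.\<close>

lemma clique_path_seq_successively:
  assumes "successively (\<lambda>x y. y = 2 \<or> y = Suc x) xs"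
  shows "successively (\<lambda>x y. y = 2 \<or> y = Suc x) (xs @ concat (map (\<lambda>p. [2..<p]) ps))"
  using assms
proof (induction ps arbitrary: xs)
  case (Cons p ps)
  have "successively (\<lambda>x y. y = 2 \<or> y = Suc x) [2..<p]"
    by (simp add: successively_conv_nth)
  then have "successively (\<lambda>x y. y = 2 \<or> y = Suc x) (xs @ [2..<p])"
    using Cons.prems by (cases "2 < p") (auto simp: successively_append_iff)
  from Cons.IH[OF this] show ?case by simp
qed simp

lemma clique_path_seq_nth:
  assumes "2 \<le> i" "i < length (clique_path_seq ps)"
  shows "clique_path_seq ps ! i = 2 \<or> clique_path_seq ps ! i = Suc (clique_path_seq ps ! (i - 1))"
proof -
  have "successively (\<lambda>x y. y = 2 \<or> y = Suc x) (clique_path_seq ps)"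
    unfolding clique_path_seq_def by (rule clique_path_seq_successively) simp
  moreover have "Suc (i - 1) = i" using assms(1) by simp
  ultimately show ?thesis using assms(2) unfolding successively_conv_nth by metis
qed

text \<open>An entry 2 gives \<open>b_index\<close> the value \<open>k - 1\<close>, hence two
  neighbours. An entry one larger than its predecessor leaves \<open>b_index\<close> unchanged,
  which forces the same extra neighbour as before and yields a twin of \<open>k - 1\<close>.\<close>

lemma neighborhood_sequence_step:
  assumes W: "neighborhood_sequence (clique_path_seq ps) W"
    and k: "2 \<le> k" "k \<le> length (clique_path_seq ps)"
  shows "(\<exists>a\<in>W (k - 1). W k = {a, k - 1}) \<or> W k = insert (k - 1) (W (k - 1))"
proof (cases "k = 2")
  case True
  then show ?thesis using W by (simp add: neighborhood_sequence_def)
next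
  case False
  let ?q = "clique_path_seq ps"
  have k3: "k \<in> {3..length ?q}" using k False by auto
  note W' = W[unfolded neighborhood_sequence_def] and nl = W[unfolded neighborhood_sequence_def non_leaping_def]
  obtain a where a: "a \<in> W (k - 1)" "a < b_index ?q k" "W k = {a} \<union> {b_index ?q k..k - 1}"
    using W' k3 by blast
  show ?thesis
  proof (cases "?q ! (k - 1) = 2")
    case True
    then have "b_index ?q k = k - 1" by (simp add: b_index_def)
    then show ?thesis using a by auto
  next
    case False
    have "k - 1 - 1 = k - 2" by simp
    then have up: "?q ! (k - 1) = Suc (?q ! (k - 2))"
      using clique_path_seq_nth[of "k - 1" ps] False k3 by auto
    have "?q ! 1 = 1" using nl by blast
    \<comment> \<open>At \<open>k = 3\<close> the preceding entry is 1, so an increase would give 2,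
      which this case excludes.\<close>
    then have "k \<noteq> 3" using up False by auto
    then have k4: "k - 1 \<in> {3..length ?q}" using k3 by auto
    have beq: "b_index ?q k = b_index ?q (k - 1)"
      using up k3 by (simp add: b_index_def numeral_2_eq_2)
    have "2 \<le> ?q ! (k - 2)" using nl k4 \<open>k - 1 - 1 = k - 2\<close> by metis
    then have ble: "b_index ?q (k - 1) \<le> k - 1" 
      using k4 by (simp add: b_index_def numeral_2_eq_2)
    obtain a' where a': "a' < b_index ?q (k - 1)" "W (k - 1) = {a'} \<union> {b_index ?q (k - 1)..k - 1 - 1}"
      using W' k4 by blast
    \<comment> \<open>The only element of \<open>W (k - 1)\<close> below the common
      \<open>b_index\<close> is \<open>a'\<close>.\<close>
    have "a = a'" using a a' beq by auto
    moreover have "{b_index ?q (k - 1)..k - 1} = insert (k - 1) {b_index ?q (k - 1)..k - 1 - 1}"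
      using ble k3 by auto
    ultimately show ?thesis using a a' beq by auto
  qed
qed

lemma distance_on_bij:
  fixes h :: "'b \<Rightarrow> 'a"
  assumes h: "inj_on h A"
    and E: "\<And>i j. i \<in> A \<Longrightarrow> j \<in> A \<Longrightarrow> E (h i) (h j) \<longleftrightarrow> F i j"
    and d: "distance_on F A d" "strict_negative_type A d"
  shows "\<exists>d'. distance_on E (h ` A) d' \<and> strict_negative_type (h ` A) d'"
proof (intro exI conjI)
  define g where "g = the_inv_into A h"
  define d' where "d' u v = d (g u) (g v)" for u v
  have gh [simp]: "i \<in> A \<Longrightarrow> g (h i) = i" for i
    unfolding g_def using h by (rule the_inv_into_f_f)
  show "distance_on E (h ` A) d'"
    unfolding distance_on_def
  proof (intro conjI ballI impI; elim imageE)
    fix u i assume "i \<in> A" "u = h i"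
    then show "d' u u = 0" using distance_onD(1)[OF d(1)] by (simp add: d'_def)
  next
    fix u v i j assume "i \<in> A" "u = h i" "j \<in> A" "v = h j"
    then show "d' u v = d' v u" using distance_onD(2)[OF d(1), of i j] by (simp add: d'_def)
  next
    fix u v w i j k
    assume "E v w" "i \<in> A" "u = h i" "j \<in> A" "v = h j" "k \<in> A" "w = h k"
    then show "d' u w \<le> Suc (d' u v)"
      using distance_onD(3)[OF d(1), of i j k] by (simp add: d'_def E)
  next
    fix u v i j assume *: "u \<noteq> v" "i \<in> A" "u = h i" "j \<in> A" "v = h j"
    then obtain k where "k \<in> A" "F k j" "d i j = Suc (d i k)"
      using distance_onD(4)[OF d(1), of i j] by auto
    then show "\<exists>w\<in>h ` A. E w v \<and> d' u v = Suc (d' u w)"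
      using * by (intro bexI[of _ "h k"]) (simp_all add: d'_def E)
  qed
  show "strict_negative_type (h ` A) d'"
    unfolding strict_negative_type_def
  proof (intro allI impI)
    fix x :: "'a \<Rightarrow> real"
    assume "sum x (h ` A) = 0" "\<exists>v\<in>h ` A. x v \<noteq> 0"
    then have "sum (x \<circ> h) A = 0" "\<exists>v\<in>A. (x \<circ> h) v \<noteq> 0"
      using h by (auto simp: sum.reindex)
    then have "dform A d (x \<circ> h) < 0" using d(2) unfolding strict_negative_type_def by blast
    moreover have "dform (h ` A) d' x = dform A d (x \<circ> h)"
      unfolding dform_def d'_def by (simp add: sum.reindex[OF h])
    ultimately show "dform (h ` A) d' x < 0" by simp
  qed
qed

text \<open>The size bound later rules out a graph with a single vertex, which would be its own
  block.\<close>

lemma two_clique_path_negative_type: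
  assumes "two_clique_path H"
  shows "2 \<le> card (verts H)"
    and "\<exists>d. distance_on (\<lambda>u v. u \<rightarrow>\<^bsub>H\<^esub> v) (verts H) d \<and> strict_negative_type (verts H) d"
proof -
  obtain ps W f where W: "neighborhood_sequence (clique_path_seq ps) W"
    and f: "pre_digraph.digraph_isomorphism (with_proj (nbhd_graph (length (clique_path_seq ps)) W)) f"
    and H: "H = app_iso f (with_proj (nbhd_graph (length (clique_path_seq ps)) W))"
    using assms unfolding two_clique_path_def digraph_iso_def by blast
  define n where "n = length (clique_path_seq ps)"
  define h where "h = iso_verts f"
  let ?N = "with_proj (nbhd_graph n W)"
  have n: "2 \<le> n" by (simp add: n_def clique_path_seq_def)
  note iso = f[folded n_def, unfolded pre_digraph.digraph_isomorphism_def]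
  have inj: "inj_on h {1..n}" using iso by (simp add: h_def nbhd_graph_def)
  have vH: "verts H = h ` {1..n}" by (simp add: H h_def n_def nbhd_graph_def)
  show "2 \<le> card (verts H)" unfolding vH using card_image[OF inj] n by simp
  have edge: "h i \<rightarrow>\<^bsub>H\<^esub> h j \<longleftrightarrow> path_edge W n i j" if ij: "i \<in> {1..n}" "j \<in> {1..n}" for i j
  proof -
    have ends: "arcs_ends H = (\<lambda>a. (h (fst a), h (snd a))) ` parcs (nbhd_graph n W)"
    proof -
      have "arcs_ends H = (\<lambda>a. (iso_tail f (iso_arcs f a), iso_head f (iso_arcs f a))) ` arcs ?N"
        unfolding arcs_ends_conv H n_def by (simp add: image_image)
      also have "\<dots> = (\<lambda>a. (h (tail ?N a), h (head ?N a))) ` arcs ?N"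
        using iso unfolding h_def by (intro image_cong) auto
      finally show ?thesis by simp
    qed
    have "h i \<rightarrow>\<^bsub>H\<^esub> h j \<longleftrightarrow> (i, j) \<in> parcs (nbhd_graph n W)"
    proof
      assume "h i \<rightarrow>\<^bsub>H\<^esub> h j"
      then obtain a where a: "a \<in> parcs (nbhd_graph n W)" "h i = h (fst a)" "h j = h (snd a)"
        unfolding ends by blast
      \<comment> \<open>\<open>h\<close> is injective only on \<open>{1..n}\<close>, so the ends of
        \<open>a\<close> must first be located there.\<close>
      have "wf_digraph ?N" using iso by blast
      from wf_digraph.wellformed[OF this] a(1) have "fst a \<in> {1..n}" "snd a \<in> {1..n}"
        by (simp_all add: nbhd_graph_def)
      then have "i = fst a" "j = snd a" using a(2,3) inj ij by (auto dest: inj_onD)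
      then show "(i, j) \<in> parcs (nbhd_graph n W)" using a(1) by simp
    next
      assume "(i, j) \<in> parcs (nbhd_graph n W)"
      then show "h i \<rightarrow>\<^bsub>H\<^esub> h j" unfolding ends by force
    qed
    then show ?thesis by (auto simp: nbhd_graph_def path_edge_def)
  qed
  have "W 1 = {}" using W by (simp add: neighborhood_sequence_def)
  then obtain d where "distance_on (path_edge W n) {1..n} d" "strong_negative_type {1..n} d n"
    using path_negative_type[where W = W and n = n and k = n] neighborhood_sequence_step[OF W] n
    unfolding n_def by fastforce
  then show "\<exists>d. distance_on (\<lambda>u v. u \<rightarrow>\<^bsub>H\<^esub> v) (verts H) d \<and> strict_negative_type (verts H) d"
    unfolding vH strong_negative_type_def
    by (intro distance_on_bij[OF inj, where F = "path_edge W n"] edge) auto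
qed

section \<open>Connectedness, blocks and distances in terms of the adjacency relation\<close>

lemma (in sym_digraph) connected_iff:
  "Digraph_Component.connected G \<longleftrightarrow>
    verts G \<noteq> {} \<and> (\<forall>u\<in>verts G. \<forall>v\<in>verts G. (u, v) \<in> (arcs_ends G)\<^sup>*)"
  \<comment> \<open>Connectedness refers to the symmetric closure, which adds nothing when the arcs
    are already symmetric.\<close>
  unfolding Digraph_Component.connected_def strongly_connected_def
  using reachable_mk_symmetric_eq[OF sym_arcs]
  by (auto simp: reachable_conv' mk_symmetric_def)

lemma arcs_ends_induce: "arcs_ends (G \<restriction> K) = edges_in (\<lambda>u v. u \<rightarrow>\<^bsub>G\<^esub> v) K"
  by (auto simp: arcs_ends_conv edges_in_def)

lemma arcs_ends_del_vert_induce: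
  "arcs_ends (pre_digraph.del_vert (G \<restriction> K) c) = edges_in (\<lambda>u v. u \<rightarrow>\<^bsub>G\<^esub> v) (K - {c})"
  by (auto simp: arcs_ends_conv edges_in_def pre_digraph.del_vert_def)

text \<open>\<open>cut_vertex\<close> asks for a pair that was joined before the deletion; in a
  connected subgraph every pair is, so that clause disappears.\<close>

lemma (in sym_digraph) biconnected_iff:
  assumes K: "K \<subseteq> verts G"
  shows "biconnected_in (\<lambda>u v. u \<rightarrow>\<^bsub>G\<^esub> v) K \<longleftrightarrow>
    Digraph_Component.connected (G \<restriction> K) \<and> (\<nexists>c. cut_vertex (G \<restriction> K) c)"
proof -
  let ?E = "\<lambda>u v. u \<rightarrow>\<^bsub>G\<^esub> v" and ?H = "G \<restriction> K"
  interpret H: sym_digraph ?H by (rule induced_graph_imp_graph) (rule induced_induce[OF K])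
  have conn: "Digraph_Component.connected ?H \<longleftrightarrow> connected_in ?E K"
    unfolding H.connected_iff connected_in_def arcs_ends_induce by simp
  have cut: "cut_vertex ?H c \<longleftrightarrow> c \<in> K \<and>
      (\<exists>u\<in>K - {c}. \<exists>v\<in>K - {c}. (u, v) \<notin> (edges_in ?E (K - {c}))\<^sup>*)"
    if "connected_in ?E K" for c
  proof -
    interpret D: wf_digraph "pre_digraph.del_vert ?H c" by (rule H.wf_digraph_del_vert)
    have "u \<rightarrow>\<^sup>*\<^bsub>?H\<^esub> v" if "u \<in> K" "v \<in> K" for u v
      using that \<open>connected_in ?E K\<close> by (simp add: H.reachable_conv' arcs_ends_induce connected_in_def)
    moreover have "u \<rightarrow>\<^sup>*\<^bsub>pre_digraph.del_vert ?H c\<^esub> v \<longleftrightarrow> (u, v) \<in> (edges_in ?E (K - {c}))\<^sup>*"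
      if "u \<in> K - {c}" for u v
    proof -
      have "verts (pre_digraph.del_vert ?H c) = K - {c}" by (simp add: pre_digraph.del_vert_def)
      then show ?thesis
        using that D.reachable_conv'[of u v] unfolding arcs_ends_del_vert_induce by blast
    qed
    ultimately show ?thesis unfolding cut_vertex_def by auto
  qed
  show ?thesis
    unfolding biconnected_in_def conn using cut by blast
qed

text \<open>An induced subgraph is determined by its vertex set, so maximality among subgraphs
  follows from maximality among vertex sets.\<close>

lemma (in sym_digraph) is_block_if_block_in:
  assumes "block_in (\<lambda>u v. u \<rightarrow>\<^bsub>G\<^esub> v) (verts G) K"
  shows "is_block (G \<restriction> K) G"
proof -
  have K: "K \<subseteq> verts G" and bic: "biconnected_in (\<lambda>u v. u \<rightarrow>\<^bsub>G\<^esub> v) K"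
    and max: "\<And>L. L \<subseteq> verts G \<Longrightarrow> biconnected_in (\<lambda>u v. u \<rightarrow>\<^bsub>G\<^esub> v) L \<Longrightarrow> K \<subseteq> L \<Longrightarrow> L = K"
    using assms unfolding block_in_def by blast+
  have ind: "induced_subgraph (G \<restriction> K) G" by (rule induced_induce[OF K])
  have "H' = G \<restriction> K"
    if H': "subgraph (G \<restriction> K) H'" "subgraph H' G" "induced_subgraph H' G"
      "Digraph_Component.connected H'" "\<nexists>v. cut_vertex H' v" for H'
  proof -
    \<comment> \<open>Equality of graphs as records also involves the maps \<open>tail\<close> and
      \<open>head\<close>, which a subgraph shares with \<open>G\<close>.\<close>
    have "tail H' = tail G" "head H' = head G" "arcs H' = {e \<in> arcs G. tail G e \<in> verts H' \<and> head G e \<in> verts H'}"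
      using H'(2,3) unfolding subgraph_def induced_subgraph_def compatible_def by auto
    then have eq: "H' = G \<restriction> verts H'" by (simp add: induce_subgraph_def)
    have sub: "verts H' \<subseteq> verts G" "K \<subseteq> verts H'" using H'(1,2) by (auto simp: subgraph_def)
    have "biconnected_in (\<lambda>u v. u \<rightarrow>\<^bsub>G\<^esub> v) (verts H')"
      using biconnected_iff[OF sub(1)] H'(4,5) eq by metis
    then show ?thesis using max sub eq by metis
  qed
  then show ?thesis
    unfolding is_block_def max_subgraph_def
    using ind induced_imp_subgraph[OF ind] bic[unfolded biconnected_iff[OF K]] by blast
qed

text \<open>The Lipschitz condition bounds every walk from below, and the descent condition builds a
  walk attaining the bound, so the infimum is a minimum.\<close>

lemma (in sym_digraph) graph_dist_eq:
  assumes d: "distance_on (\<lambda>u v. u \<rightarrow>\<^bsub>G\<^esub> v) (verts G) d" and uv: "u \<in> verts G" "v \<in> verts G"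
  shows "graph_dist G u v = real (d u v)"
proof -
  note D = distance_onD[OF d]
  have lower: "d u v \<le> length p" if "awalk u p v" for u p v
    using that
  proof (induction p arbitrary: u)
    case Nil
    then show ?case using D(1) by (auto simp: awalk_Nil_iff)
  next
    case (Cons e p)
    then have e: "e \<in> arcs G" "u = tail G e" and w: "awalk (head G e) p v"
      by (auto simp: awalk_Cons_iff)
    have V: "u \<in> verts G" "head G e \<in> verts G" "v \<in> verts G" using e w by auto
    have "u \<rightarrow>\<^bsub>G\<^esub> head G e" using e by (auto simp: arcs_ends_conv)
    then have "head G e \<rightarrow>\<^bsub>G\<^esub> u" by (rule graph_symmetric)
    then have "d v u \<le> Suc (d v (head G e))" using D(3)[OF V(3,2,1)] by blast
    then show ?case using Cons.IH[OF w] D(2)[OF V(3,1)] D(2)[OF V(3,2)] by simp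
  qed
  have upper: "\<exists>p. awalk u p v \<and> length p = d u v" if "u \<in> verts G" for u
    using that
  proof (induction "d u v" arbitrary: u)
    case 0
    then have "u = v" using D(4)[of u v] uv by fastforce
    then show ?case using 0 by (intro exI[of _ "[]"]) (simp add: awalk_Nil_iff)
  next
    case (Suc m)
    then have "u \<noteq> v" using D(1) uv by fastforce
    \<comment> \<open>Descent moves the second argument of \<open>d\<close>, while the walk grows at
      its start \<open>u\<close>; symmetry of \<open>d\<close> mediates.\<close>
    then obtain w where w: "w \<in> verts G" "w \<rightarrow>\<^bsub>G\<^esub> u" "d v u = Suc (d v w)"
      using D(4)[of v u] uv Suc by auto
    then have "m = d w v" using Suc D(2)[of v u] D(2)[of v w] uv by simp
    then obtain p where p: "awalk w p v" "length p = m" using Suc.hyps(1) w by metis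
    obtain e where "e \<in> arcs G" "tail G e = u" "head G e = w"
      using graph_symmetric[OF w(2)] by (rule reachableE)
    then show ?case using p Suc by (intro exI[of _ "e # p"]) (auto simp: awalk_Cons_iff)
  qed
  have cost: "awalk_cost (\<lambda>_. 1) p = real (length p)" for p :: "'b list"
    by (induction p) auto
  obtain p where p: "awalk u p v" "length p = d u v" using upper uv by blast
  have "\<mu> (\<lambda>_. 1) u v = ereal (real (d u v))"
    unfolding \<mu>_def
  proof (rule antisym)
    show "(INF p\<in>{p. awalk u p v}. ereal (awalk_cost (\<lambda>_. 1) p)) \<le> ereal (real (d u v))"
      using p by (intro INF_lower2[of p]) (auto simp: cost)
    show "ereal (real (d u v)) \<le> (INF p\<in>{p. awalk u p v}. ereal (awalk_cost (\<lambda>_. 1) p))"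
      using lower by (intro INF_greatest) (simp add: cost)
  qed
  then show ?thesis by (simp add: graph_dist_def)
qed

subsection \<open>Inertia of a conditionally negative definite matrix\<close>

lemma order_prod_list_linear:
  fixes es :: "'a :: field list"
  shows "Polynomial.order x (\<Prod>e\<leftarrow>es. [:- e, 1:]) = count_list es x"
proof (induction es)
  case (Cons e es)
  have "(\<Prod>e\<leftarrow>es. [:- e, 1:]) \<noteq> 0" by (auto simp: prod_list_zero_iff)
  then have nz: "[:- e, 1:] * (\<Prod>e\<leftarrow>es. [:- e, 1:]) \<noteq> 0"
    by (intro no_zero_divisors) simp_all
  show ?case using Cons.IH by (simp add: order_mult[OF nz] order_linear' del: mult_pCons_left)
qed (simp add: order_0I)

lemma num_eigenvalues_in_eq:
  assumes A: "A \<in> carrier_mat n n" and cp: "char_poly A = (\<Prod>e\<leftarrow>es. [:- e, 1:])"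
  shows "num_eigenvalues_in A S = length (filter (\<lambda>e. e \<in> S) es)"
proof -
  have "poly (char_poly A) x = 0 \<longleftrightarrow> x \<in> set es" for x
    unfolding cp by (induction es) auto
  then have ev: "{x. eigenvalue A x \<and> x \<in> S} = set (filter (\<lambda>e. e \<in> S) es)"
    using eigenvalue_root_char_poly[OF A] by auto
  have "count_list es x = count_list (filter (\<lambda>e. e \<in> S) es) x" if "x \<in> S" for x
    using that by (induction es) auto
  then have "num_eigenvalues_in A S
      = sum (count_list (filter (\<lambda>e. e \<in> S) es)) (set (filter (\<lambda>e. e \<in> S) es))"
    unfolding num_eigenvalues_in_def ev cp order_prod_list_linear by (intro sum.cong) auto
  then show ?thesis by (simp add: sum_count_set)
qed

text \<open>The polynomial splits over the complex numbers; symmetry makes every root real, and the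
  factorization descends to the reals coefficientwise.\<close>

lemma symmetric_char_poly_factorized:
  fixes A :: "real mat"
  assumes A: "A \<in> carrier_mat n n" and sym: "\<And>i j. i < n \<Longrightarrow> j < n \<Longrightarrow> A $$ (i, j) = A $$ (j, i)"
  shows "\<exists>es. char_poly A = (\<Prod>e\<leftarrow>es. [:- e, 1:]) \<and> length es = n"
proof -
  define C where "C = map_mat complex_of_real A"
  have C: "C \<in> carrier_mat n n" using A by (simp add: C_def)
  have cpC: "char_poly C = map_poly complex_of_real (char_poly A)"
    unfolding C_def by (rule of_real_hom.char_poly_hom[OF A])
  obtain as where as: "char_poly C = (\<Prod>a\<leftarrow>as. [:- a, 1:])" "length as = n"
    using char_poly_factorized[OF C] by blast
  have real: "complex_of_real (Re a) = a" if "a \<in> set as" for a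
  proof -
    have "poly (char_poly C) a = 0" using that unfolding as(1) by (induction as) auto
    then obtain v where v: "v \<in> carrier_vec n" "v \<noteq> 0\<^sub>v n" "C *\<^sub>v v = a \<cdot>\<^sub>v v"
      using C unfolding eigenvalue_root_char_poly[OF C, symmetric] eigenvalue_def eigenvector_def
      by auto
    \<comment> \<open>For an eigenvector \<open>v\<close>, these are the Hermitian form of
      \<open>A\<close> at \<open>v\<close> and the squared norm of \<open>v\<close>. The form is its
      own conjugate, so \<open>a\<close> is real.\<close>
    define S where "S = (\<Sum>i<n. \<Sum>j<n. complex_of_real (A $$ (i, j)) * (cnj (v $ i) * v $ j))"
    define N where "N = (\<Sum>i<n. (cmod (v $ i))\<^sup>2)"
    have row: "(\<Sum>j<n. complex_of_real (A $$ (i, j)) * v $ j) = a * v $ i" if "i < n" for i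
    proof -
      have "(C *\<^sub>v v) $ i = (\<Sum>j<n. complex_of_real (A $$ (i, j)) * v $ j)"
        using that A v(1) by (auto simp: C_def scalar_prod_def atLeast0LessThan intro!: sum.cong)
      then show ?thesis using that v by simp
    qed
    have "S = (\<Sum>i<n. cnj (v $ i) * (\<Sum>j<n. complex_of_real (A $$ (i, j)) * v $ j))"
      unfolding S_def by (simp add: sum_distrib_left mult.left_commute)
    also have "\<dots> = (\<Sum>i<n. a * of_real ((cmod (v $ i))\<^sup>2))"
    proof (intro sum.cong refl)
      fix i assume "i \<in> {..<n}"
      then have "cnj (v $ i) * (\<Sum>j<n. complex_of_real (A $$ (i, j)) * v $ j)
        = cnj (v $ i) * (a * v $ i)" by (simp only: row lessThan_iff)
      then show "cnj (v $ i) * (\<Sum>j<n. complex_of_real (A $$ (i, j)) * v $ j)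
        = a * of_real ((cmod (v $ i))\<^sup>2)" by (simp only: complex_norm_square mult_ac)
    qed
    also have "\<dots> = a * of_real N" by (simp add: N_def sum_distrib_left)
    finally have SN: "S = a * of_real N" .
    have "cnj S = (\<Sum>i<n. \<Sum>j<n. complex_of_real (A $$ (i, j)) * (v $ i * cnj (v $ j)))"
      unfolding S_def by simp
    also have "\<dots> = (\<Sum>j<n. \<Sum>i<n. complex_of_real (A $$ (i, j)) * (v $ i * cnj (v $ j)))"
      by (rule sum.swap)
    also have "\<dots> = S"
      unfolding S_def using sym by (intro sum.cong refl) (simp add: mult_ac)
    finally have "cnj a * of_real N = a * of_real N" using SN by simp
    moreover have "N \<noteq> 0"
    proof
      assume "N = 0"
      then have "\<forall>i<n. v $ i = 0" unfolding N_def by (subst (asm) sum_nonneg_eq_0_iff) auto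
      then show False using v(1,2) by (auto simp: vec_eq_iff)
    qed
    ultimately have "cnj a = a" by simp
    then show ?thesis by (metis Reals_cnj_iff of_real_Re)
  qed
  interpret map_poly_hom: map_poly_comm_ring_hom complex_of_real ..
  define es where "es = map Re as"
  have "map_poly complex_of_real (\<Prod>e\<leftarrow>es. [:- e, 1:]) = (\<Prod>a\<leftarrow>as. [:- a, 1:])"
    unfolding es_def using real
  proof (induction as)
    case (Cons a as)
    then show ?case
      by (simp add: map_poly_hom.hom_mult map_poly_pCons del: mult_pCons_left)
  qed simp
  then have "map_poly complex_of_real (\<Prod>e\<leftarrow>es. [:- e, 1:]) = map_poly complex_of_real (char_poly A)"
    using cpC as(1) by simp
  then have "char_poly A = (\<Prod>e\<leftarrow>es. [:- e, 1:])"
    by (simp add: poly_eq_iff coeff_map_poly)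
  moreover have "length es = n" using as(2) by (simp add: es_def)
  ultimately show ?thesis by blast
qed

section \<open>Trace and Schur form\<close>

lemma trace_mult_comm:
  fixes A B :: "'a :: comm_semiring_0 mat"
  assumes "A \<in> carrier_mat n n" "B \<in> carrier_mat n n"
  shows "(\<Sum>i<n. (A * B) $$ (i, i)) = (\<Sum>i<n. (B * A) $$ (i, i))"
proof -
  have "(\<Sum>i<n. (A * B) $$ (i, i)) = (\<Sum>i<n. \<Sum>j<n. A $$ (i, j) * B $$ (j, i))"
    using assms by (intro sum.cong refl) (auto simp: scalar_prod_def atLeast0LessThan)
  also have "\<dots> = (\<Sum>j<n. \<Sum>i<n. A $$ (i, j) * B $$ (j, i))" by (rule sum.swap)
  also have "\<dots> = (\<Sum>i<n. (B * A) $$ (i, i))"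
    using assms by (intro sum.cong refl)
      (auto simp: scalar_prod_def atLeast0LessThan mult.commute intro!: sum.cong)
  finally show ?thesis .
qed

text \<open>The diagonal follows the order of \<open>es\<close>, which may be any ordering of the
  eigenvalues; thus two chosen ones can be placed first.\<close>

lemma schur_exists:
  fixes A :: "real mat"
  assumes A: "A \<in> carrier_mat n n" and cp: "char_poly A = (\<Prod>e\<leftarrow>es. [:- e, 1:])"
  obtains B P Q where "B \<in> carrier_mat n n" "P \<in> carrier_mat n n" "Q \<in> carrier_mat n n"
    "P * Q = 1\<^sub>m n" "Q * P = 1\<^sub>m n" "A = P * B * Q" "upper_triangular B" "diag_mat B = es"
proof -
  obtain B P Q where "schur_decomposition A es = (B, P, Q)" by (metis prod_cases3)
  from schur_decomposition[OF A cp this]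
  have wit: "similar_mat_wit A B P Q" and B: "upper_triangular B" "diag_mat B = es"
    by auto
  from similar_mat_witD2[OF A wit] B show ?thesis by (intro that[of B P Q]) blast+
qed

lemma sum_eigenvalues:
  fixes A :: "real mat"
  assumes A: "A \<in> carrier_mat n n" and cp: "char_poly A = (\<Prod>e\<leftarrow>es. [:- e, 1:])"
  shows "sum_list es = (\<Sum>i<n. A $$ (i, i))"
proof -
  obtain B P Q where BPQ: "B \<in> carrier_mat n n" "P \<in> carrier_mat n n" "Q \<in> carrier_mat n n"
    "P * Q = 1\<^sub>m n" "Q * P = 1\<^sub>m n" "A = P * B * Q" "diag_mat B = es"
    using schur_exists[OF A cp] by metis
  have "(\<Sum>i<n. A $$ (i, i)) = (\<Sum>i<n. (Q * (P * B)) $$ (i, i))"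
    unfolding BPQ(6) using BPQ by (intro trace_mult_comm) auto
  also have "Q * (P * B) = B"
    using assoc_mult_mat[OF BPQ(3,2,1)] left_mult_one_mat[OF BPQ(1)] BPQ(5) by simp
  also have "(\<Sum>i<n. B $$ (i, i)) = sum_list es"
    unfolding BPQ(7)[symmetric] using BPQ(1)
    by (simp add: diag_mat_def interv_sum_list_conv_sum_set_nat atLeast0LessThan)
  finally show ?thesis ..
qed

text \<open>Two nonnegative eigenvalues would give an invariant plane on which the form is
  nonnegative, but every plane contains a nonzero vector with entry sum 0.\<close>

lemma at_most_one_nonnegative_eigenvalue:
  fixes A :: "real mat"
  assumes A: "A \<in> carrier_mat n n" and sym: "\<And>i j. i < n \<Longrightarrow> j < n \<Longrightarrow> A $$ (i, j) = A $$ (j, i)"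
    and neg: "\<And>x. (\<Sum>i<n. x i) = 0 \<Longrightarrow> \<exists>i<n. x i \<noteq> 0 \<Longrightarrow>
      (\<Sum>i<n. \<Sum>j<n. x i * x j * A $$ (i, j)) < 0"
    and cp: "char_poly A = (\<Prod>e\<leftarrow>l1 # l2 # es. [:- e, 1:])"
  shows "l1 < 0 \<or> l2 < 0"
proof (rule ccontr)
  assume "\<not> ?thesis"
  then have pos: "0 \<le> l1" "0 \<le> l2" by auto
  obtain B P Q where BPQ: "B \<in> carrier_mat n n" "P \<in> carrier_mat n n" "Q \<in> carrier_mat n n"
    "P * Q = 1\<^sub>m n" "Q * P = 1\<^sub>m n" "A = P * B * Q" "upper_triangular B" "diag_mat B = l1 # l2 # es"
    using schur_exists[OF A cp] by metis
  have len: "n = length es + 2" using BPQ(1) arg_cong[OF BPQ(8), of length] by (simp add: diag_mat_def)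
  have dB: "(l1 # l2 # es) ! i = B $$ (i, i)" if "i < n" for i
    unfolding BPQ(8)[symmetric] using that BPQ(1) by (simp add: diag_mat_def)
  have B00: "B $$ (0, 0) = l1" and B11: "B $$ (1, 1) = l2"
    using dB[of 0] dB[of 1] len by simp_all
  have AP: "A * P = P * B"
  proof -
    have "P * B \<in> carrier_mat n n" using BPQ(1,2) by simp
    then show ?thesis unfolding BPQ(6) using BPQ(2,3,5) by (simp add: assoc_mult_mat[where n\<^sub>2 = n] right_mult_one_mat[where nc = n])
  qed
  \<comment> \<open>The first two columns of \<open>P\<close> span the plane. They are not assumed
    orthogonal, so their Gram entries \<open>a\<close>, \<open>b\<close>, \<open>c\<close> appear
    below.\<close>
  define p q where "p i = P $$ (i, 0)" and "q i = P $$ (i, 1)" for i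
  define t where "t = B $$ (0, 1)"
  have APij: "(\<Sum>k<n. A $$ (i, k) * P $$ (k, j)) = (\<Sum>k<n. P $$ (i, k) * B $$ (k, j))"
    if "i < n" "j < n" for i j
    using arg_cong[OF AP, of "\<lambda>M. M $$ (i, j)"] that A BPQ(1,2)
    by (auto simp: scalar_prod_def atLeast0LessThan)
  have Ap: "(\<Sum>k<n. A $$ (i, k) * p k) = l1 * p i" if "i < n" for i
  proof -
    have "(\<Sum>k<n. P $$ (i, k) * B $$ (k, 0)) = (\<Sum>k\<in>{0}. P $$ (i, k) * B $$ (k, 0))"
      using len BPQ(1) upper_triangularD[OF BPQ(7)] by (intro sum.mono_neutral_right) auto
    then show ?thesis using APij[of i 0] that len B00 by (simp add: p_def)
  qed
  have Aq: "(\<Sum>k<n. A $$ (i, k) * q k) = t * p i + l2 * q i" if "i < n" for i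
  proof -
    have "(\<Sum>k<n. P $$ (i, k) * B $$ (k, 1)) = (\<Sum>k\<in>{0, 1}. P $$ (i, k) * B $$ (k, 1))"
      using len BPQ(1) upper_triangularD[OF BPQ(7)] by (intro sum.mono_neutral_right) auto
    then show ?thesis using APij[of i 1] that len B11 by (simp add: p_def q_def t_def)
  qed
  have indep: "\<alpha> = 0 \<and> \<beta> = 0" if z: "\<And>i. i < n \<Longrightarrow> \<alpha> * p i + \<beta> * q i = 0" for \<alpha> \<beta>
  proof -
    have QP: "(\<Sum>i<n. Q $$ (k, i) * P $$ (i, j)) = (if k = j then 1 else 0)" if "k < n" "j < n" for k j
      using arg_cong[OF BPQ(5), of "\<lambda>M. M $$ (k, j)"] that BPQ(2,3)
      by (auto simp: scalar_prod_def atLeast0LessThan)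
    have "0 = (\<Sum>i<n. Q $$ (k, i) * (\<alpha> * p i + \<beta> * q i))" for k using z by simp
    also have "\<dots> k = \<alpha> * (\<Sum>i<n. Q $$ (k, i) * P $$ (i, 0)) + \<beta> * (\<Sum>i<n. Q $$ (k, i) * P $$ (i, 1))" for k
      by (simp add: p_def q_def sum_distrib_left sum.distrib algebra_simps)
    finally have eq: "0 = \<alpha> * (\<Sum>i<n. Q $$ (k, i) * P $$ (i, 0)) + \<beta> * (\<Sum>i<n. Q $$ (k, i) * P $$ (i, 1))" for k .
    have n2: "0 < n" "1 < n" using len by auto
    show ?thesis
      using eq[of 0, unfolded QP[OF n2(1) n2(1)] QP[OF n2(1) n2(2)]]
        eq[of 1, unfolded QP[OF n2(2) n2(1)] QP[OF n2(2) n2(2)]] by simp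
  qed
  define a b c where "a = (\<Sum>i<n. p i * p i)" and "b = (\<Sum>i<n. p i * q i)" and "c = (\<Sum>i<n. q i * q i)"
  have form: "(\<Sum>i<n. \<Sum>j<n. f i * g j * A $$ (i, j)) = (\<Sum>i<n. f i * (\<Sum>j<n. A $$ (i, j) * g j))"
    for f g :: "nat \<Rightarrow> real"
    by (simp add: sum_distrib_left mult_ac)
  have formp: "(\<Sum>i<n. \<Sum>j<n. f i * p j * A $$ (i, j)) = l1 * (\<Sum>i<n. p i * f i)" for f
  proof -
    have "(\<Sum>i<n. f i * (\<Sum>j<n. A $$ (i, j) * p j)) = (\<Sum>i<n. f i * (l1 * p i))"
      by (intro sum.cong) (simp_all add: Ap)
    then show ?thesis unfolding form by (simp add: sum_distrib_left mult_ac)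
  qed
  have formq: "(\<Sum>i<n. \<Sum>j<n. f i * q j * A $$ (i, j))
      = t * (\<Sum>i<n. p i * f i) + l2 * (\<Sum>i<n. f i * q i)" for f
  proof -
    have "(\<Sum>i<n. f i * (\<Sum>j<n. A $$ (i, j) * q j)) = (\<Sum>i<n. f i * (t * p i + l2 * q i))"
      by (intro sum.cong) (simp_all add: Aq)
    then show ?thesis unfolding form by (simp add: sum_distrib_left sum.distrib algebra_simps)
  qed
  have pAp: "(\<Sum>i<n. \<Sum>j<n. p i * p j * A $$ (i, j)) = l1 * a"
    and qAp: "(\<Sum>i<n. \<Sum>j<n. q i * p j * A $$ (i, j)) = l1 * b"
    and pAq: "(\<Sum>i<n. \<Sum>j<n. p i * q j * A $$ (i, j)) = t * a + l2 * b"
    and qAq: "(\<Sum>i<n. \<Sum>j<n. q i * q j * A $$ (i, j)) = t * b + l2 * c"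
    unfolding formp formq a_def b_def c_def by simp_all
  have comm: "(\<Sum>i<n. \<Sum>j<n. q i * p j * A $$ (i, j)) = (\<Sum>i<n. \<Sum>j<n. p i * q j * A $$ (i, j))"
  proof -
    have "(\<Sum>i<n. \<Sum>j<n. q i * p j * A $$ (i, j)) = (\<Sum>j<n. \<Sum>i<n. q i * p j * A $$ (i, j))"
      by (rule sum.swap)
    also have "\<dots> = (\<Sum>j<n. \<Sum>i<n. p j * q i * A $$ (j, i))"
      using sym by (intro sum.cong refl) simp
    finally show ?thesis .
  qed
  \<comment> \<open>Symmetry of \<open>A\<close> determines the off-diagonal entry \<open>t\<close>
    of the triangular form.\<close>
  have rel: "t * a = (l1 - l2) * b" using comm qAp pAq by (simp add: algebra_simps)
  have "a \<noteq> 0"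
  proof
    assume "a = 0"
    then have "\<forall>i<n. p i = 0" unfolding a_def by (subst (asm) sum_nonneg_eq_0_iff) auto
    then show False using indep[of 1 0] by simp
  qed
  then have a: "a > 0" unfolding a_def by (simp add: sum_nonneg less_le)
  have cs: "b\<^sup>2 \<le> a * c"
    using Cauchy_Schwarz_ineq_sum[of p q "{..<n}"] unfolding a_def b_def c_def by (simp add: power2_eq_square)
  \<comment> \<open>A nontrivial solution of one linear equation in two unknowns gives the vector of
    entry sum 0 in the plane.\<close>
  obtain \<alpha> \<beta> where ab: "\<alpha> * sum p {..<n} + \<beta> * sum q {..<n} = 0" "\<alpha> \<noteq> 0 \<or> \<beta> \<noteq> 0"
  proof (cases "sum p {..<n} = 0")
    case True then show ?thesis using that[of 1 0] by simp
  next
    case False then show ?thesis using that[of "sum q {..<n}" "- sum p {..<n}"] by simp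
  qed
  define x where "x i = \<alpha> * p i + \<beta> * q i" for i
  have "(\<Sum>i<n. x i) = 0" using ab(1) by (simp add: x_def sum.distrib sum_distrib_left)
  moreover have "\<exists>i<n. x i \<noteq> 0" using indep[of \<alpha> \<beta>] ab(2) unfolding x_def by blast
  ultimately have "(\<Sum>i<n. \<Sum>j<n. x i * x j * A $$ (i, j)) < 0" by (rule neg)
  also have "(\<Sum>i<n. \<Sum>j<n. x i * x j * A $$ (i, j))
    = \<alpha>\<^sup>2 * (l1 * a) + \<alpha> * \<beta> * (t * a + l2 * b) + \<alpha> * \<beta> * (l1 * b) + \<beta>\<^sup>2 * (t * b + l2 * c)"
    unfolding pAp[symmetric] qAp[symmetric] pAq[symmetric] qAq[symmetric]
    by (simp add: x_def sum.distrib sum_distrib_left algebra_simps power2_eq_square)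
  \<comment> \<open>Multiplication by \<open>a > 0\<close> makes \<open>t\<close> occur only as
    \<open>t * a\<close>, so \<open>rel\<close> eliminates it. What remains is nonnegative by the
    Cauchy-Schwarz bound \<open>cs\<close>.\<close>
  finally have "a * (\<alpha>\<^sup>2 * (l1 * a) + \<alpha> * \<beta> * (t * a + l2 * b) + \<alpha> * \<beta> * (l1 * b) + \<beta>\<^sup>2 * (t * b + l2 * c)) < 0"
    using a by (simp add: mult_pos_neg)
  also have "a * (\<alpha>\<^sup>2 * (l1 * a) + \<alpha> * \<beta> * (t * a + l2 * b) + \<alpha> * \<beta> * (l1 * b) + \<beta>\<^sup>2 * (t * b + l2 * c))
    = l1 * (\<alpha> * a)\<^sup>2 + \<alpha> * \<beta> * a * (t * a) + \<alpha> * \<beta> * a * (l2 + l1) * b + \<beta>\<^sup>2 * b * (t * a) + \<beta>\<^sup>2 * l2 * a * c"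
    by (simp add: algebra_simps power2_eq_square)
  also have "\<dots> = l1 * (\<alpha> * a + \<beta> * b)\<^sup>2 + l2 * \<beta>\<^sup>2 * (a * c - b\<^sup>2)"
    unfolding rel by (simp add: algebra_simps power2_eq_square)
  finally show False
    using pos cs by (smt (verit) mult_nonneg_nonneg zero_le_power2)
qed

text \<open>The zero diagonal makes the eigenvalues sum to 0. Without a positive one there could be
  no negative one either, leaving at most one eigenvalue in all, against
  \<open>2 \<le> n\<close>.\<close>

theorem inertia_conditionally_negative:
  fixes A :: "real mat"
  assumes A: "A \<in> carrier_mat n n" and n: "2 \<le> n"
    and sym: "\<And>i j. i < n \<Longrightarrow> j < n \<Longrightarrow> A $$ (i, j) = A $$ (j, i)"
    and diag: "\<And>i. i < n \<Longrightarrow> A $$ (i, i) = 0"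
    and neg: "\<And>x. (\<Sum>i<n. x i) = 0 \<Longrightarrow> \<exists>i<n. x i \<noteq> 0 \<Longrightarrow>
      (\<Sum>i<n. \<Sum>j<n. x i * x j * A $$ (i, j)) < 0"
  shows "inertia A = (1, n - 1, 0)"
proof -
  obtain es where cp: "char_poly A = (\<Prod>e\<leftarrow>es. [:- e, 1:])" and len: "length es = n"
    using symmetric_char_poly_factorized[OF A sym] by blast
  define pos zer ng where "pos = filter (\<lambda>e. e \<in> {0<..}) es"
    and "zer = filter (\<lambda>e. e \<in> {0}) es" and "ng = filter (\<lambda>e. e \<in> {..<0}) es"
  have split: "length pos + length zer + length ng = n"
    unfolding len[symmetric] pos_def zer_def ng_def by (induction es) auto
  have ssplit: "sum_list pos + sum_list ng = sum_list es" and ms: "mset es = mset (pos @ zer @ ng)"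
    unfolding pos_def zer_def ng_def by (induction es) auto
  have s0: "sum_list es = 0" using sum_eigenvalues[OF A cp] diag by simp
  have le1: "length (pos @ zer) \<le> 1"
  proof (rule ccontr)
    assume "\<not> ?thesis"
    then obtain l1 l2 r where r: "pos @ zer = l1 # l2 # r"
      by (metis (no_types) One_nat_def Suc_le_length_iff not_less_eq_eq)
    \<comment> \<open>The product of linear factors depends only on the multiset of roots, so two
      nonnegative ones can be moved to the front.\<close>
    have "mset es = mset (l1 # l2 # (r @ ng))" using ms r by (metis append.assoc append_Cons)
    then have "char_poly A = (\<Prod>e\<leftarrow>l1 # l2 # (r @ ng). [:- e, 1:])"
      unfolding cp prod_mset_prod_list[symmetric] mset_map by (rule arg_cong)
    then have "l1 < 0 \<or> l2 < 0"
      using at_most_one_nonnegative_eigenvalue[OF A] sym neg by blast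
    moreover have "\<forall>e\<in>set (pos @ zer). 0 \<le> e" by (auto simp: pos_def zer_def)
    ultimately show False unfolding r by auto
  qed
  have "pos \<noteq> []"
  proof
    assume "pos = []"
    then have "sum_list ng = 0" using ssplit s0 by simp
    moreover have "\<forall>e\<in>set ng. e < 0" by (auto simp: ng_def)
    then have "ng = [] \<or> sum_list ng < 0"
    proof (induction ng)
      case (Cons e ng) then show ?case by (cases "ng = []") auto
    qed simp
    ultimately have "ng = []" by auto
    then show False using split le1 n \<open>pos = []\<close> by simp
  qed
  then have "length pos \<noteq> 0" by simp
  then have "length pos = 1" "length zer = 0" "length ng = n - 1"
    using le1 split unfolding length_append by linarith+
  then show ?thesis
    unfolding inertia_def num_eigenvalues_in_eq[OF A cp] pos_def zer_def ng_def by simp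
qed

section \<open>Inertia of the distance matrix\<close>

theorem theorem5p6:
  fixes G :: "('a, 'b) pre_digraph" and vs :: "'a list" and n :: nat
  assumes "graph G"
    and "Digraph_Component.connected G"
    and "card (verts G) = n"
    and "\<And>H. is_block H G \<Longrightarrow> two_clique_path H"
    and "distinct vs" and "set vs = verts G"
  shows "inertia (distance_matrix G vs) = (1, n - 1, 0)"
proof -
  interpret graph G by fact
  let ?E = "\<lambda>u v. u \<rightarrow>\<^bsub>G\<^esub> v" and ?V = "verts G"
  have block: "2 \<le> card K" "\<exists>d. distance_on ?E K d \<and> strict_negative_type K d"
    if K: "block_in ?E ?V K" for K
  proof -
    have clique: "two_clique_path (G \<restriction> K)" by (rule assms(4)[OF is_block_if_block_in[OF K]])
    show "2 \<le> card K" using two_clique_path_negative_type(1)[OF clique] by simp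
    obtain d where d: "distance_on (\<lambda>u v. u \<rightarrow>\<^bsub>G \<restriction> K\<^esub> v) K d" "strict_negative_type K d"
      using two_clique_path_negative_type(2)[OF clique] by auto
    have "distance_on ?E K d"
      using d(1) unfolding distance_on_def arcs_ends_induce edges_in_def by simp
    then show "\<exists>d. distance_on ?E K d \<and> strict_negative_type K d" using d(2) by blast
  qed
  have "arcs_ends G = edges_in ?E ?V" by (auto simp: edges_in_def arcs_ends_conv)
  then have conn: "connected_in ?E ?V"
    using assms(2) unfolding connected_iff connected_in_def by simp
  \<comment> \<open>A single vertex would itself be a block, but a two-clique path has at least two
    vertices.\<close>
  have n: "2 \<le> n"
  proof (rule ccontr)
    assume "\<not> 2 \<le> n"
    moreover have "?V \<noteq> {}" using conn by (simp add: connected_in_def)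
    ultimately have "card ?V = 1" using assms(3) by (metis card_0_eq finite_verts less_2_cases not_le One_nat_def)
    then obtain v where v: "?V = {v}" by (auto simp: card_1_singleton_iff)
    then have "biconnected_in ?E ?V" using conn by (auto simp: biconnected_in_def)
    then have "block_in ?E ?V ?V" unfolding block_in_def by blast
    then show False using block(1)[of ?V] \<open>card ?V = 1\<close> by simp
  qed
  obtain d where d: "distance_on ?E ?V d" "strict_negative_type ?V d"
    using strict_negative_type_from_blocks[OF finite_verts graph_symmetric conn block(2)] by blast
  have len: "length vs = n" using distinct_card[OF assms(5)] assms(3,6) by simp
  have bij: "bij_betw ((!) vs) {..<n} ?V"
    using bij_betw_nth[OF assms(5), of "{..<n}" ?V] assms(6) len by simp
  have mem: "vs ! i \<in> ?V" if "i < n" for i using that len assms(6) nth_mem by metis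
  have entry: "distance_matrix G vs $$ (i, j) = real (d (vs ! i) (vs ! j))" if "i < n" "j < n" for i j
    using that len mem graph_dist_eq[OF d(1)] by (simp add: distance_matrix_def)
  show ?thesis
  proof (rule inertia_conditionally_negative[OF _ n])
    show "distance_matrix G vs \<in> carrier_mat n n" by (simp add: distance_matrix_def len)
    show "distance_matrix G vs $$ (i, j) = distance_matrix G vs $$ (j, i)" if "i < n" "j < n" for i j
      using that distance_onD(2)[OF d(1) mem mem] by (simp add: entry)
    show "distance_matrix G vs $$ (i, i) = 0" if "i < n" for i
      using that distance_onD(1)[OF d(1) mem mem] by (simp add: entry)
    fix x :: "nat \<Rightarrow> real"
    assume x: "(\<Sum>i<n. x i) = 0" "\<exists>i<n. x i \<noteq> 0"
    \<comment> \<open>\<open>y\<close> carries the weights from matrix indices to vertices along the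
      enumeration \<open>vs\<close>.\<close>
    define y where "y u = x (the_inv_into {..<n} ((!) vs) u)" for u
    have y: "y (vs ! i) = x i" if "i < n" for i
      unfolding y_def using the_inv_into_f_f[OF bij_betw_imp_inj_on[OF bij]] that by simp
    have reindex: "sum f ?V = (\<Sum>i<n. f (vs ! i))" for f :: "'a \<Rightarrow> real"
      by (rule sum.reindex_bij_betw[OF bij, symmetric])
    have "sum y ?V = 0" using x(1) by (simp add: reindex y)
    moreover have "\<exists>v\<in>?V. y v \<noteq> 0" using x(2) y mem by metis
    ultimately have "dform ?V d y < 0" using d(2) unfolding strict_negative_type_def by blast
    then show "(\<Sum>i<n. \<Sum>j<n. x i * x j * distance_matrix G vs $$ (i, j)) < 0"
      by (simp add: dform_def reindex y entry)
  qed
qed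

end
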